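(* There is an algorithm that, given a chordal bipartite graph $G$, enumerates all minimal connected dominating sets of $G$ in incremental-polynomial time.
   Context: All graphs are finite and simple. A bipartite graph is chordal bipartite if it contains no induced cycle of length greater than four. A dominating set of $G$ is a set $D\subseteq V(G)$ such that every vertex of $G$ is in $D$ or adjacent to a vertex of $D$; it is connected if $G[D]$ is connected, and a minimal connected dominating set is an inclusion-wise minimal connected dominating set. An enumeration algorithm runs in incremental-polynomial time if, for every $i$, it outputs the $i$-th solution (and, after the last solution, halts) within time polynomial in the input size plus $i$; every solution is output exactly once. *)

theory Defs
  imports "Graph_Theory.Graph_Theory" "HOL-Computational_Algebra.Polynomial"
begin

section \<open>Graphs\<close>

text \<open>
  A finite simple graph is a \<^locale>\<open>pair_graph\<close>: a finite, loop-free, symmetric digraph without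
  parallel arcs; each edge is the pair of its two opposite arcs.
\<close>

definition bipartite :: "'a pair_pre_digraph \<Rightarrow> bool" where
  "bipartite G \<longleftrightarrow> (\<exists>A B. A \<union> B = pverts G \<and> A \<inter> B = {} \<and> parcs G \<subseteq> A \<times> B \<union> B \<times> A)"

text \<open>
  A closed walk back and forth along one edge also satisfies \<^const>\<open>pre_digraph.cycle\<close>; the length
  bound in the definition of chordal bipartite graphs rules it out.
\<close>

definition induced_cycle :: "'a pair_pre_digraph \<Rightarrow> ('a \<times> 'a) list \<Rightarrow> bool" where
  "induced_cycle G p \<longleftrightarrow> pre_digraph.cycle (with_proj G) p \<and>
     arcs (with_proj G \<restriction> (fst ` set p)) \<subseteq> set p \<union> (set p)\<inverse>"

definition chordal_bipartite :: "'a pair_pre_digraph \<Rightarrow> bool" where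
  "chordal_bipartite G \<longleftrightarrow>
     pair_graph G \<and> bipartite G \<and> (\<nexists>p. induced_cycle G p \<and> length p > 4)"

definition dominating_set :: "'a pair_pre_digraph \<Rightarrow> 'a set \<Rightarrow> bool" where
  "dominating_set G D \<longleftrightarrow>
     D \<subseteq> pverts G \<and> (\<forall>v\<in>pverts G. v \<in> D \<or> (\<exists>u\<in>D. u \<rightarrow>\<^bsub>with_proj G\<^esub> v))"

definition connected_dominating_set :: "'a pair_pre_digraph \<Rightarrow> 'a set \<Rightarrow> bool" where
  "connected_dominating_set G D \<longleftrightarrow> dominating_set G D \<and> connected (with_proj G \<restriction> D)"

definition minimal_connected_dominating_set :: "'a pair_pre_digraph \<Rightarrow> 'a set \<Rightarrow> bool" where
  "minimal_connected_dominating_set G D \<longleftrightarrow>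
     connected_dominating_set G D \<and> (\<forall>D'. D' \<subset> D \<longrightarrow> \<not> connected_dominating_set G D')"

section \<open>Model of computation\<close>

text \<open>
  Algorithms are programs of the WHILE language over binary trees (N. D. Jones, Computability and
  Complexity, MIT Press 1997), extended by an output instruction. A program has finitely many
  variables, each holding a (pointer to a) binary tree. Every elementary operation costs one unit:
  building a node allocates one cell sharing its two subtrees, and the only test is whether a tree
  is a leaf, so that running times agree with those of Turing machines up to a polynomial.
  Output of a tree is charged its size in addition, since sharing would otherwise allow a short run
  to emit an exponentially large tree. The datatype size of a tree is its number of nodes other
  than leaves.
\<close>

datatype tree = Leaf | Node tree tree

primrec left :: "tree \<Rightarrow> tree" where
  "left Leaf = Leaf"
| "left (Node l r) = l"

primrec right :: "tree \<Rightarrow> tree" where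
  "right Leaf = Leaf"
| "right (Node l r) = r"

datatype expr = Var nat | LeafE | NodeE expr expr | LeftE expr | RightE expr

type_synonym state = "nat \<Rightarrow> tree"

primrec expr_value :: "expr \<Rightarrow> state \<Rightarrow> tree" where
  "expr_value (Var x) s = s x"
| "expr_value LeafE s = Leaf"
| "expr_value (NodeE a b) s = Node (expr_value a s) (expr_value b s)"
| "expr_value (LeftE a) s = left (expr_value a s)"
| "expr_value (RightE a) s = right (expr_value a s)"

primrec expr_cost :: "expr \<Rightarrow> nat" where
  "expr_cost (Var x) = 1"
| "expr_cost LeafE = 1"
| "expr_cost (NodeE a b) = expr_cost a + expr_cost b + 1"
| "expr_cost (LeftE a) = expr_cost a + 1"
| "expr_cost (RightE a) = expr_cost a + 1"

datatype prog =
    Skip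
  | Assign nat expr
  | Output expr
  | Seq prog prog
  | If expr prog prog
  | While expr prog

definition delay :: "nat \<Rightarrow> (nat \<times> tree) list \<Rightarrow> (nat \<times> tree) list" where
  "delay t out = map (\<lambda>(k, v). (t + k, v)) out"

text \<open>
  \<open>exec c s t out s'\<close>: started in state \<open>s\<close>, the program \<open>c\<close> halts after \<open>t\<close> time units in state
  \<open>s'\<close>, and \<open>out\<close> lists its outputs in the order of emission, each with the time at which it is
  completed. A tree counts as true if it is not a leaf.
\<close>

inductive exec :: "prog \<Rightarrow> state \<Rightarrow> nat \<Rightarrow> (nat \<times> tree) list \<Rightarrow> state \<Rightarrow> bool" where
  Skip: "exec Skip s 1 [] s"
| Assign: "exec (Assign x e) s (expr_cost e + 1) [] (s(x := expr_value e s))"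
| Output: "t = expr_cost e + size (expr_value e s) + 1 \<Longrightarrow>
    exec (Output e) s t [(t, expr_value e s)] s"
| Seq: "exec c1 s t1 out1 s' \<Longrightarrow> exec c2 s' t2 out2 s'' \<Longrightarrow>
    exec (Seq c1 c2) s (t1 + t2) (out1 @ delay t1 out2) s''"
| IfTrue: "expr_value e s \<noteq> Leaf \<Longrightarrow> k = expr_cost e + 1 \<Longrightarrow> exec c1 s t out s' \<Longrightarrow>
    exec (If e c1 c2) s (k + t) (delay k out) s'"
| IfFalse: "expr_value e s = Leaf \<Longrightarrow> k = expr_cost e + 1 \<Longrightarrow> exec c2 s t out s' \<Longrightarrow>
    exec (If e c1 c2) s (k + t) (delay k out) s'"
| WhileFalse: "expr_value e s = Leaf \<Longrightarrow> exec (While e c) s (expr_cost e + 1) [] s"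
| WhileTrue: "expr_value e s \<noteq> Leaf \<Longrightarrow> k = expr_cost e + 1 \<Longrightarrow>
    exec c s t1 out1 s' \<Longrightarrow> exec (While e c) s' t2 out2 s'' \<Longrightarrow>
    exec (While e c) s (k + t1 + t2) (delay k out1 @ delay (k + t1) out2) s''"

inductive_cases exec_SkipE: "exec Skip s t out s'"
inductive_cases exec_AssignE: "exec (Assign x e) s t out s'"
inductive_cases exec_OutputE: "exec (Output e) s t out s'"
inductive_cases exec_SeqE: "exec (Seq c1 c2) s t out s'"
inductive_cases exec_IfE: "exec (If e c1 c2) s t out s'"
inductive_cases exec_WhileE: "exec (While e c) s t out s'"

lemma exec_deterministic:
  "exec c s t out s' \<Longrightarrow> exec c s u out' s'' \<Longrightarrow> u = t \<and> out' = out \<and> s'' = s'"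
proof (induction arbitrary: u out' s'' rule: exec.induct)
  case (Skip s)
  then show ?case by (rule exec_SkipE) simp
next
  case (Assign x e s)
  then show ?case by (rule exec_AssignE) simp
next
  case (Output t e s)
  then show ?case by (simp, elim exec_OutputE) simp
next
  case (Seq c1 s t1 out1 s1 c2 t2 out2 s2)
  from Seq.prems show ?case
    by (rule exec_SeqE) (metis Seq.IH)
next
  case (IfTrue e s k c1 t out s' c2)
  from IfTrue.prems show ?case
    by (rule exec_IfE) (auto simp: IfTrue.hyps dest: IfTrue.IH)
next
  case (IfFalse e s k c2 t out s' c1)
  from IfFalse.prems show ?case
    by (rule exec_IfE) (auto simp: IfFalse.hyps dest: IfFalse.IH)
next
  case (WhileFalse e s c)
  from WhileFalse.prems show ?case
    by (rule exec_WhileE) (use WhileFalse.hyps in simp_all)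
next
  case (WhileTrue e s k c t1 out1 s1 t2 out2 s2)
  from WhileTrue.prems show ?case
    by (rule exec_WhileE) (auto simp: WhileTrue.hyps dest!: WhileTrue.IH)
qed

definition initial_state :: "tree \<Rightarrow> state" where
  "initial_state v = (\<lambda>_. Leaf)(0 := v)"

text \<open>
  \<open>I\<close> is the set of instances, \<open>enc\<close> their encoding and \<open>Sol x\<close> the set of encoded solutions of
  the instance \<open>x\<close>. The \<open>i\<close>-th output is the list element with index \<open>i - 1\<close>.
\<close>

definition enumerates_in_incremental_poly_time ::
    "prog \<Rightarrow> 'i set \<Rightarrow> ('i \<Rightarrow> tree) \<Rightarrow> ('i \<Rightarrow> tree set) \<Rightarrow> bool" where
  "enumerates_in_incremental_poly_time c I enc Sol \<longleftrightarrow>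
     (\<exists>p :: nat poly. \<forall>x\<in>I. \<exists>t out s'.
        exec c (initial_state (enc x)) t out s' \<and>
        distinct (map snd out) \<and> set (map snd out) = Sol x \<and>
        (\<forall>i\<in>{1..length out}. fst (out ! (i - 1)) \<le> poly p (size (enc x) + i)) \<and>
        t \<le> poly p (size (enc x) + length out))"

section \<open>Encoding of graphs and vertex sets\<close>

text \<open>
  Graphs given to an algorithm have vertex set \<open>{0..<n}\<close> and are presented by their adjacency
  matrix; a set of vertices is presented by its characteristic vector of length \<open>n\<close>.
\<close>

definition tree_of_bool :: "bool \<Rightarrow> tree" where
  "tree_of_bool b = (if b then Node Leaf Leaf else Leaf)"

definition tree_of_list :: "tree list \<Rightarrow> tree" where
  "tree_of_list vs = foldr Node vs Leaf"

definition tree_of_set :: "nat \<Rightarrow> nat set \<Rightarrow> tree" where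
  "tree_of_set n D = tree_of_list (map (\<lambda>v. tree_of_bool (v \<in> D)) [0..<n])"

definition tree_of_graph :: "nat pair_pre_digraph \<Rightarrow> tree" where
  "tree_of_graph G = (let n = card (pverts G) in
     tree_of_list (map (\<lambda>u. tree_of_set n {v. (u, v) \<in> parcs G}) [0..<n]))"

end

theory Submission
  imports Defs
begin

text \<open>
  Let \<open>\<G>\<close> be the solutions found so far and \<open>D\<^sub>0\<close> a further one. Extend \<open>D\<^sub>0\<close> to a maximal vertex set \<open>D\<close>
  containing no member of \<open>\<G>\<close>, and let \<open>X\<close> be its complement; each \<open>y \<in> X\<close> has some \<open>g\<^sub>y \<in> \<G>\<close> with
  \<open>y \<in> g\<^sub>y\<close> and \<open>g\<^sub>y - {y} \<subseteq> D\<close>. In a chordal bipartite graph the common neighbourhood of any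
  subset of one side is that of at most two of its elements (no induced 6-cycle), and two vertices of
  one side outside a maximal set \<open>D'\<close> that is not a connected dominating set have a common neighbour in every
  component of \<open>D'\<close> (no induced cycle of length greater than four). Hence \<open>X\<close> has at most four
  elements \<open>Y\<close> such that every such \<open>D'\<close> disjoint from \<open>Y\<close> is disjoint from \<open>X\<close>: an
  \<open>x \<in> X \<inter> D'\<close> would be joined to two components of \<open>D'\<close>. So extending the union of the
  \<open>g\<^sub>y - {y}\<close>, \<open>y \<in> Y\<close>, greedily to a maximal set \<open>D'\<close> containing no member of \<open>\<G>\<close> yields a
  connected dominating set, for otherwise \<open>D' \<subseteq> D\<close> and thus \<open>D' = D\<close>. Any minimal one below it is new, and there
  are only polynomially many choices of \<open>Y\<close> and \<open>g\<^sub>y\<close>.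
\<close>

section \<open>Polynomial-time functions\<close>

definition polynomial :: "(nat \<Rightarrow> nat) \<Rightarrow> bool" where
  "polynomial T \<longleftrightarrow> (\<exists>p :: nat poly. T = poly p)"

named_theorems polynomial_intros

lemma polynomial_const [polynomial_intros]: "polynomial (\<lambda>_. c)"
  unfolding polynomial_def by (rule exI[of _ "[:c:]"]) auto

lemma polynomial_id [polynomial_intros]: "polynomial (\<lambda>n. n)"
  unfolding polynomial_def by (rule exI[of _ "[:0, 1:]"]) auto

lemma polynomial_add [polynomial_intros]:
  "polynomial S \<Longrightarrow> polynomial T \<Longrightarrow> polynomial (\<lambda>n. S n + T n)"
  unfolding polynomial_def
proof (elim exE)
  fix p q :: "nat poly" assume "S = poly p" "T = poly q"
  then show "\<exists>r :: nat poly. (\<lambda>n. S n + T n) = poly r"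
    by (intro exI[of _ "p + q"]) auto
qed

lemma polynomial_mult [polynomial_intros]:
  "polynomial S \<Longrightarrow> polynomial T \<Longrightarrow> polynomial (\<lambda>n. S n * T n)"
  unfolding polynomial_def
proof (elim exE)
  fix p q :: "nat poly" assume "S = poly p" "T = poly q"
  then show "\<exists>r :: nat poly. (\<lambda>n. S n * T n) = poly r"
    by (intro exI[of _ "p * q"]) auto
qed

lemma polynomial_comp: "polynomial T \<Longrightarrow> polynomial S \<Longrightarrow> polynomial (\<lambda>n. T (S n))"
  unfolding polynomial_def
proof (elim exE)
  fix p q :: "nat poly" assume "T = poly p" "S = poly q"
  then show "\<exists>r :: nat poly. (\<lambda>n. T (S n)) = poly r"
    by (intro exI[of _ "pcompose p q"]) (auto simp: poly_pcompose)
qed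

text \<open>Coefficients in \<open>nat\<close> make evaluation monotone, so a time bound may be
  evaluated at an upper bound for a size.\<close>

lemma polynomial_mono:
  assumes "polynomial T" "m \<le> n"
  shows "T m \<le> T n"
proof -
  have "poly p m \<le> poly p n" for p :: "nat poly"
    using \<open>m \<le> n\<close> by (induction p) (auto intro: mult_mono)
  with assms show ?thesis by (auto simp: polynomial_def)
qed

section \<open>Runs without output within a time budget\<close>

definition runs :: "prog \<Rightarrow> state \<Rightarrow> nat \<Rightarrow> state \<Rightarrow> bool" where
  "runs c s T s' \<longleftrightarrow> (\<exists>t\<le>T. exec c s t [] s')"

lemma delay_Nil [simp]: "delay k [] = []"
  by (simp add: delay_def)

lemma runs_mono: "runs c s T s' \<Longrightarrow> T \<le> T' \<Longrightarrow> runs c s T' s'"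
  unfolding runs_def using le_trans by blast

lemma runs_Skip: "runs Skip s 1 s"
  unfolding runs_def using exec.Skip by blast

lemma runs_Assign: "runs (Assign x e) s (expr_cost e + 1) (s(x := expr_value e s))"
  unfolding runs_def using exec.Assign by blast

lemma runs_Assign_eq:
  "t = expr_cost e + 1 \<Longrightarrow> s' = s(x := expr_value e s) \<Longrightarrow> runs (Assign x e) s t s'"
  using runs_Assign by simp

lemma runs_Seq:
  assumes "runs c1 s T1 s1" "runs c2 s1 T2 s2"
  shows "runs (Seq c1 c2) s (T1 + T2) s2"
proof -
  obtain t1 t2 where "t1 \<le> T1" "t2 \<le> T2" "exec c1 s t1 [] s1" "exec c2 s1 t2 [] s2"
    using assms unfolding runs_def by blast
  with exec.Seq[OF this(3,4)] show ?thesis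
    unfolding runs_def by (intro exI[of _ "t1 + t2"]) simp
qed

lemma runs_IfTrue:
  assumes "expr_value e s \<noteq> Leaf" "runs c1 s T s'"
  shows "runs (If e c1 c2) s (expr_cost e + 1 + T) s'"
proof -
  obtain t where "t \<le> T" "exec c1 s t [] s'"
    using assms unfolding runs_def by blast
  with exec.IfTrue[OF assms(1) refl this(2)] show ?thesis
    unfolding runs_def by (intro exI[of _ "expr_cost e + 1 + t"]) simp
qed

lemma runs_IfFalse:
  assumes "expr_value e s = Leaf" "runs c2 s T s'"
  shows "runs (If e c1 c2) s (expr_cost e + 1 + T) s'"
proof -
  obtain t where "t \<le> T" "exec c2 s t [] s'"
    using assms unfolding runs_def by blast
  with exec.IfFalse[OF assms(1) refl this(2)] show ?thesis
    unfolding runs_def by (intro exI[of _ "expr_cost e + 1 + t"]) simp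
qed

lemma runs_WhileFalse: "expr_value e s = Leaf \<Longrightarrow> runs (While e c) s (expr_cost e + 1) s"
  unfolding runs_def using exec.WhileFalse by blast

lemma runs_WhileTrue:
  assumes "expr_value e s \<noteq> Leaf" "runs c s T1 s1" "runs (While e c) s1 T2 s2"
  shows "runs (While e c) s (expr_cost e + 1 + T1 + T2) s2"
proof -
  obtain t1 t2 where "t1 \<le> T1" "t2 \<le> T2" "exec c s t1 [] s1" "exec (While e c) s1 t2 [] s2"
    using assms unfolding runs_def by blast
  with exec.WhileTrue[OF assms(1) refl this(3,4)] show ?thesis
    unfolding runs_def by (intro exI[of _ "expr_cost e + 1 + t1 + t2"]) simp
qed

section \<open>Encoding of data types as trees\<close>

class enc =
  fixes encode :: "'a \<Rightarrow> tree"

abbreviation sz :: "'a :: enc \<Rightarrow> nat" where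
  "sz x \<equiv> size (encode x)"

instantiation unit :: enc
begin
definition "encode (x :: unit) = Leaf"
instance ..
end

instantiation bool :: enc
begin
definition "encode (b :: bool) = tree_of_bool b"
instance ..
end

text \<open>In unary, a number and a list of that many units are the same tree, so a number can
  drive a loop over a list. The only numbers that occur are vertices and lengths of lists, so unary
  notation is affordable.\<close>

instantiation nat :: enc
begin
definition "encode (n :: nat) = tree_of_list (replicate n Leaf)"
instance ..
end

instantiation list :: (enc) enc
begin
definition "encode (xs :: 'a list) = tree_of_list (map encode xs)"
instance ..
end

instantiation prod :: (enc, enc) enc
begin
definition "encode (z :: 'a \<times> 'b) = Node (encode (fst z)) (encode (snd z))"
instance ..
end

lemma encode_Pair [simp]: "encode (a, b) = Node (encode a) (encode b)"
  by (simp add: encode_prod_def)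

lemma encode_Nil [simp]: "encode [] = Leaf"
  by (simp add: encode_list_def tree_of_list_def)

lemma encode_Cons [simp]: "encode (x # xs) = Node (encode x) (encode xs)"
  by (simp add: encode_list_def tree_of_list_def)

lemma encode_True [simp]: "encode True = Node Leaf Leaf"
  by (simp add: encode_bool_def tree_of_bool_def)

lemma encode_False [simp]: "encode False = Leaf"
  by (simp add: encode_bool_def tree_of_bool_def)

lemma encode_0 [simp]: "encode (0 :: nat) = Leaf"
  by (simp add: encode_nat_def tree_of_list_def)

lemma encode_Suc [simp]: "encode (Suc n) = Node Leaf (encode n)"
  by (simp add: encode_nat_def tree_of_list_def)

lemma encode_tl: "encode (tl xs) = right (encode xs)"
  by (cases xs) auto

lemma size_right: "size (right t) \<le> size t"
  by (cases t) auto

lemma encode_unit [simp]: "encode (u :: unit) = Leaf"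
  by (simp add: encode_unit_def)

lemma encode_bool_eq_Leaf [simp]: "encode b = Leaf \<longleftrightarrow> \<not> b"
  by (cases b) auto

lemma encode_list_eq_Leaf [simp]: "encode xs = Leaf \<longleftrightarrow> xs = []"
  by (cases xs) auto

lemma sz_bool: "sz (b :: bool) \<le> 1"
  by (cases b) auto

lemma sz_nat [simp]: "sz (n :: nat) = n"
  by (induction n) auto

lemma sz_append [simp]: "sz (xs @ ys) = sz xs + sz ys"
  by (induction xs) auto

lemma sz_in_set: "x \<in> set xs \<Longrightarrow> sz x < sz xs"
  by (induction xs) auto

lemma length_le_sz: "length xs \<le> sz xs"
  by (induction xs) auto

lemma sz_filter: "sz (filter P xs) \<le> sz xs"
  by (induction xs) auto

lemma encode_replicate_unit: "encode (replicate n ()) = encode n"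
  by (induction n) auto

text \<open>Variable 0 carries both the argument and the result. The other variables may start with
  arbitrary contents, and those from \<open>m\<close> on are preserved, so that a caller can keep
  its own data there.\<close>

definition computes ::
    "prog \<Rightarrow> nat \<Rightarrow> (nat \<Rightarrow> nat) \<Rightarrow> ('a :: enc \<Rightarrow> 'b :: enc) \<Rightarrow> bool" where
  "computes c m T f \<longleftrightarrow> (\<forall>s x. s 0 = encode x \<longrightarrow> sz (f x) \<le> T (sz x) \<and>
     (\<exists>s'. runs c s (T (sz x)) s' \<and> s' 0 = encode (f x) \<and> (\<forall>i\<ge>m. s' i = s i)))"

text \<open>
  The bound on the size of the result is not implied by the one on the running time, because the
  result may share subtrees.
\<close>

definition ptime :: "('a :: enc \<Rightarrow> 'b :: enc) \<Rightarrow> bool" where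
  "ptime f \<longleftrightarrow> (\<exists>c m T. polynomial T \<and> computes c m T f)"

section \<open>Closure rules for polynomial-time functions\<close>

named_theorems ptime_intros

lemma ptimeI: "polynomial T \<Longrightarrow> computes c m T f \<Longrightarrow> ptime f"
  unfolding ptime_def by blast

lemma computesD:
  assumes "computes c m T f" "s 0 = encode x"
  obtains s' where "runs c s (T (sz x)) s'" "s' 0 = encode (f x)" "\<And>i. m \<le> i \<Longrightarrow> s' i = s i"
  using assms unfolding computes_def by blast

lemma computes_sz: "computes c m T f \<Longrightarrow> sz (f x) \<le> T (sz x)"
  unfolding computes_def by (drule spec[of _ "\<lambda>_. encode x"]) auto

text \<open>Programs see encodings only. The result types of \<open>f\<close> and \<open>g\<close>
  may differ, which turns pairs into nonempty lists and numbers into lists of units.\<close>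

lemma ptime_encode_cong:
  assumes "ptime f" "\<And>x. encode (g x) = encode (f x)"
  shows "ptime g"
  using assms unfolding ptime_def computes_def by simp

lemma ptime_id [ptime_intros]: "ptime (\<lambda>x. x)"
proof -
  have "computes Skip 0 (\<lambda>n. n + 1) (\<lambda>x :: 'a. x)"
    unfolding computes_def using runs_mono[OF runs_Skip] by force
  moreover have "polynomial (\<lambda>n. n + 1)" by (intro polynomial_intros)
  ultimately show ?thesis by (rule ptimeI[rotated])
qed

primrec expr_of_tree :: "tree \<Rightarrow> expr" where
  "expr_of_tree Leaf = LeafE"
| "expr_of_tree (Node l r) = NodeE (expr_of_tree l) (expr_of_tree r)"

lemma expr_value_expr_of_tree [simp]: "expr_value (expr_of_tree v) s = v"
  by (induction v) auto

lemma ptime_expr: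
  fixes f :: "'a :: enc \<Rightarrow> 'b :: enc"
  assumes "\<And>s x. s 0 = encode x \<Longrightarrow> expr_value e s = encode (f x)"
    and "\<And>x. sz (f x) \<le> sz x + k"
  shows "ptime f"
proof -
  have "computes (Assign 0 e) 1 (\<lambda>n. n + k + (expr_cost e + 1)) f"
    unfolding computes_def
  proof (intro allI impI conjI)
    fix s :: state and x :: 'a assume "s 0 = encode x"
    then have v: "expr_value e s = encode (f x)" by (rule assms(1))
    show "sz (f x) \<le> sz x + k + (expr_cost e + 1)" using assms(2)[of x] by simp
    show "\<exists>s'. runs (Assign 0 e) s (sz x + k + (expr_cost e + 1)) s' \<and> s' 0 = encode (f x) \<and>
        (\<forall>i\<ge>1. s' i = s i)"
      using v by (intro exI[of _ "s(0 := expr_value e s)"]) (auto intro!: runs_mono[OF runs_Assign_eq])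
  qed
  moreover have "polynomial (\<lambda>n. n + k + (expr_cost e + 1))" by (intro polynomial_intros)
  ultimately show ?thesis by (rule ptimeI[rotated])
qed

lemma ptime_const [ptime_intros]: "ptime (\<lambda>_. c)"
  by (rule ptime_expr[of "expr_of_tree (encode c)" _ "sz c"]) auto

text \<open>The second program runs on an intermediate result of size at most \<open>T2 n\<close>.
  This bound comes from the size clause of \<open>computes\<close>; a time bound alone would not
  give it.\<close>

lemma ptime_comp:
  fixes g :: "'a :: enc \<Rightarrow> 'b :: enc" and f :: "'b \<Rightarrow> 'c :: enc"
  assumes "ptime f" "ptime g"
  shows "ptime (\<lambda>x. f (g x))"
proof -
  obtain c1 m1 T1 where T1: "polynomial T1" and c1: "computes c1 m1 T1 f"
    using assms by (auto simp: ptime_def)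
  obtain c2 m2 T2 where T2: "polynomial T2" and c2: "computes c2 m2 T2 g"
    using assms by (auto simp: ptime_def)
  have le: "T1 (sz (g x)) \<le> T1 (T2 (sz x))" for x
    by (rule polynomial_mono[OF T1 computes_sz[OF c2]])
  have "computes (Seq c2 c1) (max m1 m2) (\<lambda>n. T2 n + T1 (T2 n)) (\<lambda>x. f (g x))"
    unfolding computes_def
  proof (intro allI impI conjI)
    fix s :: state and x :: 'a assume s: "s 0 = encode x"
    show "sz (f (g x)) \<le> T2 (sz x) + T1 (T2 (sz x))"
      using computes_sz[OF c1, of "g x"] le[of x] by linarith
    obtain s1 where 1: "runs c2 s (T2 (sz x)) s1" "s1 0 = encode (g x)" "\<And>i. m2 \<le> i \<Longrightarrow> s1 i = s i"
      using computesD[OF c2, of s x, OF s] by blast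
    obtain s2 where 2: "runs c1 s1 (T1 (sz (g x))) s2" "s2 0 = encode (f (g x))"
        "\<And>i. m1 \<le> i \<Longrightarrow> s2 i = s1 i"
      using computesD[OF c1, of s1 "g x", OF 1(2)] by blast
    show "\<exists>s'. runs (Seq c2 c1) s (T2 (sz x) + T1 (T2 (sz x))) s' \<and> s' 0 = encode (f (g x)) \<and>
        (\<forall>i\<ge>max m1 m2. s' i = s i)"
      using 1 2 runs_Seq[OF 1(1) runs_mono[OF 2(1) le]] by (intro exI[of _ s2]) auto
  qed
  moreover have "polynomial (\<lambda>n. T2 n + T1 (T2 n))"
    by (intro polynomial_intros polynomial_comp[OF T1] T2)
  ultimately show ?thesis by (rule ptimeI[rotated])
qed

lemma ptime_Pair [ptime_intros]:
  fixes f :: "'a :: enc \<Rightarrow> 'b :: enc" and g :: "'a \<Rightarrow> 'c :: enc"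
  assumes "ptime f" "ptime g"
  shows "ptime (\<lambda>x. (f x, g x))"
proof -
  obtain c1 m1 T1 where T1: "polynomial T1" and c1: "computes c1 m1 T1 f"
    using assms by (auto simp: ptime_def)
  obtain c2 m2 T2 where T2: "polynomial T2" and c2: "computes c2 m2 T2 g"
    using assms by (auto simp: ptime_def)
  \<comment> \<open>Both programs preserve the variables from \<open>v\<close> on: \<open>v\<close>
    keeps the argument during \<open>c1\<close>, and \<open>v + 1\<close> keeps the first result
    during \<open>c2\<close>.\<close>
  define v where "v = max m1 m2 + 1"
  define c where "c = Seq (Assign v (Var 0)) (Seq c1 (Seq (Assign (v + 1) (Var 0))
    (Seq (Assign 0 (Var v)) (Seq c2 (Assign 0 (NodeE (Var (v + 1)) (Var 0)))))))"
  have v: "m1 \<le> v" "m2 \<le> v" "0 < v" by (auto simp: v_def)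
  have "computes c (v + 2) (\<lambda>n. 10 + T1 n + T2 n) (\<lambda>x. (f x, g x))"
    unfolding computes_def
  proof (intro allI impI conjI)
    fix s :: state and x :: 'a assume s: "s 0 = encode x"
    show "sz (f x, g x) \<le> 10 + T1 (sz x) + T2 (sz x)"
      using computes_sz[OF c1, of x] computes_sz[OF c2, of x] by simp
    have "(s(v := s 0)) 0 = encode x" using s v by auto
    from computesD[OF c1, of "s(v := s 0)" x, OF this] obtain s1 where 1: "runs c1 (s(v := s 0)) (T1 (sz x)) s1"
        "s1 0 = encode (f x)" "\<And>i. m1 \<le> i \<Longrightarrow> s1 i = (s(v := s 0)) i" by blast
    let ?s2 = "s1(v + 1 := s1 0, 0 := s1 v)"
    have "?s2 0 = encode x" using 1 v s by auto
    from computesD[OF c2, of ?s2 x, OF this] obtain s3 where 3: "runs c2 ?s2 (T2 (sz x)) s3"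
        "s3 0 = encode (g x)" "\<And>i. m2 \<le> i \<Longrightarrow> s3 i = ?s2 i" by blast
    let ?s4 = "s3(0 := Node (s3 (v + 1)) (s3 0))"
    have asg: "runs (Assign v (Var 0)) s 2 (s(v := s 0))"
      "runs (Assign (v + 1) (Var 0)) s1 2 (s1(v + 1 := s1 0))"
      "runs (Assign 0 (Var v)) (s1(v + 1 := s1 0)) 2 ?s2"
      "runs (Assign 0 (NodeE (Var (v + 1)) (Var 0))) s3 4 ?s4"
      by (auto intro!: runs_Assign_eq)
    have "runs c s (10 + T1 (sz x) + T2 (sz x)) ?s4"
      unfolding c_def
      by (rule runs_mono[OF runs_Seq[OF asg(1) runs_Seq[OF 1(1) runs_Seq[OF asg(2)
            runs_Seq[OF asg(3) runs_Seq[OF 3(1) asg(4)]]]]]]) simp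
    moreover have "?s4 0 = encode (f x, g x)" using 1 3 v by auto
    moreover have "\<forall>i\<ge>v + 2. ?s4 i = s i" using 1 3 v by auto
    ultimately show "\<exists>s'. runs c s (10 + T1 (sz x) + T2 (sz x)) s' \<and> s' 0 = encode (f x, g x) \<and>
        (\<forall>i\<ge>v + 2. s' i = s i)" by blast
  qed
  moreover have "polynomial (\<lambda>n. 10 + T1 n + T2 n)" by (intro polynomial_intros T1 T2)
  ultimately show ?thesis by (rule ptimeI[rotated])
qed

lemma ptime_fst [ptime_intros]: "ptime f \<Longrightarrow> ptime (\<lambda>x. fst (f x))"
  by (erule ptime_comp[rotated], rule ptime_expr[of "LeftE (Var 0)" _ 0]) (auto simp: encode_prod_def)

lemma ptime_snd [ptime_intros]: "ptime f \<Longrightarrow> ptime (\<lambda>x. snd (f x))"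
  by (erule ptime_comp[rotated], rule ptime_expr[of "RightE (Var 0)" _ 0]) (auto simp: encode_prod_def)

lemma ptime_Cons [ptime_intros]:
  assumes "ptime f" "ptime g"
  shows "ptime (\<lambda>x. f x # g x)"
  by (rule ptime_encode_cong[OF ptime_Pair[OF assms]]) simp

lemma ptime_tl [ptime_intros]: "ptime f \<Longrightarrow> ptime (\<lambda>x. tl (f x))"
  by (erule ptime_comp[rotated], rule ptime_expr[of "RightE (Var 0)" _ 0])
     (auto simp: encode_tl size_right)

text \<open>A bound variable becomes a further component of a tuple. The rules for all binding
  operators have this form, so that a proof of \<open>ptime\<close> can follow the syntax of the
  function.\<close>

lemma ptime_Let [ptime_intros]:
  assumes "ptime f" "ptime (\<lambda>z. g (fst z) (snd z))"
  shows "ptime (\<lambda>x. Let (f x) (g x))"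
  using ptime_comp[OF assms(2) ptime_Pair[OF ptime_id assms(1)]] by simp

lemma ptime_If [ptime_intros]:
  fixes f g :: "'a :: enc \<Rightarrow> 'b :: enc"
  assumes "ptime b" "ptime f" "ptime g"
  shows "ptime (\<lambda>x. if b x then f x else g x)"
proof -
  obtain c1 m1 T1 where T1: "polynomial T1" and c1: "computes c1 m1 T1 f"
    using assms(2) by (auto simp: ptime_def)
  obtain c2 m2 T2 where T2: "polynomial T2" and c2: "computes c2 m2 T2 g"
    using assms(3) by (auto simp: ptime_def)
  \<comment> \<open>The condition is evaluated beforehand and paired with the argument; after the
    test, the right component restores the argument.\<close>
  define c where "c = If (LeftE (Var 0)) (Seq (Assign 0 (RightE (Var 0))) c1)
    (Seq (Assign 0 (RightE (Var 0))) c2)"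
  let ?h = "\<lambda>z. if fst z then f (snd z) else g (snd z)"
  let ?T = "\<lambda>n. 6 + T1 n + T2 n"
  have "computes c (max 1 (max m1 m2)) ?T ?h"
    unfolding computes_def
  proof (intro allI impI conjI)
    fix s :: state and z :: "bool \<times> 'a" assume s: "s 0 = encode z"
    obtain b x where z: "z = (b, x)" by (cases z)
    have le: "T1 (sz x) \<le> T1 (sz z)" "T2 (sz x) \<le> T2 (sz z)"
      by (auto intro!: polynomial_mono[OF T1] polynomial_mono[OF T2] simp: z)
    show "sz (?h z) \<le> ?T (sz z)"
      using computes_sz[OF c1, of x] computes_sz[OF c2, of x] le by (cases b) (auto simp: z)
    let ?s1 = "s(0 := right (s 0))"
    have s1: "?s1 0 = encode x" using s z by simp
    have asg: "runs (Assign 0 (RightE (Var 0))) s 3 ?s1"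
      by (intro runs_Assign_eq) auto
    show "\<exists>s'. runs c s (?T (sz z)) s' \<and> s' 0 = encode (?h z) \<and>
        (\<forall>i\<ge>max 1 (max m1 m2). s' i = s i)"
    proof (cases b)
      case True
      obtain s2 where 2: "runs c1 ?s1 (T1 (sz x)) s2" "s2 0 = encode (f x)"
          "\<And>i. m1 \<le> i \<Longrightarrow> s2 i = ?s1 i"
        using computesD[OF c1, of ?s1 x, OF s1] by blast
      have "runs c s (?T (sz z)) s2" unfolding c_def
        using True s z le by (intro runs_mono[OF runs_IfTrue[OF _ runs_Seq[OF asg 2(1)]]]) simp_all
      with 2 True z show ?thesis by (intro exI[of _ s2]) auto
    next
      case False
      obtain s2 where 2: "runs c2 ?s1 (T2 (sz x)) s2" "s2 0 = encode (g x)"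
          "\<And>i. m2 \<le> i \<Longrightarrow> s2 i = ?s1 i"
        using computesD[OF c2, of ?s1 x, OF s1] by blast
      have "runs c s (?T (sz z)) s2" unfolding c_def
        using False s z le by (intro runs_mono[OF runs_IfFalse[OF _ runs_Seq[OF asg 2(1)]]]) simp_all
      with 2 False z show ?thesis by (intro exI[of _ s2]) auto
    qed
  qed
  moreover have "polynomial ?T" by (intro polynomial_intros T1 T2)
  ultimately have "ptime ?h" by (rule ptimeI[rotated])
  from ptime_comp[OF this ptime_Pair[OF assms(1) ptime_id]] show ?thesis
    by (simp only: fst_conv snd_conv)
qed

lemma ptime_is_Nil [ptime_intros]: "ptime f \<Longrightarrow> ptime (\<lambda>x. f x = [])"
proof (erule ptime_comp[rotated])
  let ?c = "If (Var 0) (Assign 0 LeafE) (Assign 0 (NodeE LeafE LeafE))"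
  have *: "runs ?c s 8 (s(0 := encode (xs = [])))" if "s 0 = encode xs" for s and xs :: "'b list"
  proof (cases xs)
    case Nil
    have "runs (Assign 0 (NodeE LeafE LeafE)) s 4 (s(0 := encode (xs = [])))"
      using Nil by (intro runs_Assign_eq) auto
    then show ?thesis
      using Nil that by (intro runs_mono[OF runs_IfFalse]) auto
  next
    case (Cons y ys)
    have "runs (Assign 0 LeafE) s 2 (s(0 := encode (xs = [])))"
      using Cons by (intro runs_Assign_eq) auto
    then show ?thesis
      using Cons that by (intro runs_mono[OF runs_IfTrue]) auto
  qed
  have "computes ?c 1 (\<lambda>_. 8) (\<lambda>xs :: 'b list. xs = [])"
    unfolding computes_def
  proof (intro allI impI conjI)
    fix s :: state and xs :: "'b list" assume s: "s 0 = encode xs"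
    show "sz (xs = []) \<le> 8" using sz_bool[of "xs = []"] by linarith
    show "\<exists>s'. runs ?c s 8 s' \<and> s' 0 = encode (xs = []) \<and> (\<forall>i\<ge>1. s' i = s i)"
      using *[of s xs, OF s] by (intro exI[of _ "s(0 := encode (xs = []))"]) auto
  qed
  then show "ptime (\<lambda>xs :: 'b list. xs = [])"
    by (rule ptimeI[OF polynomial_const])
qed

lemma ptime_not [ptime_intros]:
  assumes "ptime f"
  shows "ptime (\<lambda>x. \<not> f x)"
proof -
  have "(\<lambda>x. \<not> f x) = (\<lambda>x. if f x then False else True)" by auto
  then show ?thesis by (simp only:) (intro ptime_intros assms)
qed

lemma ptime_conj [ptime_intros]:
  assumes "ptime f" "ptime g"
  shows "ptime (\<lambda>x. f x \<and> g x)"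
proof -
  have "(\<lambda>x. f x \<and> g x) = (\<lambda>x. if f x then g x else False)" by auto
  then show ?thesis by (simp only:) (intro ptime_intros assms)
qed

lemma ptime_disj [ptime_intros]:
  assumes "ptime f" "ptime g"
  shows "ptime (\<lambda>x. f x \<or> g x)"
proof -
  have "(\<lambda>x. f x \<or> g x) = (\<lambda>x. if f x then True else g x)" by auto
  then show ?thesis by (simp only:) (intro ptime_intros assms)
qed

text \<open>
  Bounding the growth of the accumulator by the size of a polynomial-time function of the
  list element keeps the accumulator polynomial throughout the loop.
\<close>

lemma ptime_foldl:
  fixes f :: "'a :: enc \<Rightarrow> 'b :: enc \<Rightarrow> 'e :: enc \<Rightarrow> 'b" and r :: "'a \<Rightarrow> 'e \<Rightarrow> 'c :: enc"
  assumes f: "ptime (\<lambda>z. f (fst z) (fst (snd z)) (snd (snd z)))"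
    and i: "ptime i" and l: "ptime l"
    and r: "ptime (\<lambda>z. r (fst z) (snd z))"
    and growth: "\<And>x a e. sz (f x a e) \<le> sz a + sz (r x e) + 1"
  shows "ptime (\<lambda>x. foldl (f x) (i x) (l x))"
proof -
  obtain c m T where T: "polynomial T"
    and c: "computes c m T (\<lambda>z. f (fst z) (fst (snd z)) (snd (snd z)))"
    using f by (auto simp: ptime_def)
  obtain c' m' R where R: "polynomial R" and c': "computes c' m' R (\<lambda>z. r (fst z) (snd z))"
    using r by (auto simp: ptime_def)
  define v where "v = m + 1"
  have v: "m \<le> v" "0 < v" by (auto simp: v_def)
  \<comment> \<open>Variable 0 holds the accumulator, \<open>v\<close> the fixed argument and
    \<open>v + 1\<close> the rest of the list. Each round packs argument, accumulator and head into
    the triple that \<open>c\<close> expects.\<close>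
  define body where "body = Seq (Assign 0 (NodeE (Var v) (NodeE (Var 0) (LeftE (Var (v + 1))))))
    (Seq c (Assign (v + 1) (RightE (Var (v + 1)))))"
  define loop where "loop = While (Var (v + 1)) body"
  \<comment> \<open>\<open>B\<close> bounds the growth allowance of a list element, \<open>K\<close>
    every accumulator, and \<open>N + K\<close> the size of the triple given to \<open>c\<close>. A
    round costs 2 for the test and 10 for the assignments; the final 2 is the failing test.\<close>
  have loop: "sz (foldl (f x) a es) \<le> K \<and> (\<exists>s'. runs loop s (length es * (T (N + K) + 12) + 2) s' \<and>
      s' 0 = encode (foldl (f x) a es) \<and> (\<forall>i\<ge>v + 2. s' i = s i))"
    if "s 0 = encode a" "s v = encode x" "s (v + 1) = encode es"
      "\<And>e. e \<in> set es \<Longrightarrow> sz (r x e) \<le> B" "\<And>e. e \<in> set es \<Longrightarrow> sz x + sz e + 2 \<le> N"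
      "sz a + length es * (B + 1) \<le> K" for s x a es B K N
    using that
  proof (induction es arbitrary: s a)
    case Nil
    have "runs loop s 2 s"
      unfolding loop_def using Nil runs_WhileFalse[of "Var (v + 1)" s body]
      by (auto intro: runs_mono)
    with Nil show ?case by (intro conjI exI[of _ s]) (auto simp: numeral_2_eq_2)
  next
    case (Cons e es)
    let ?s1 = "s(0 := Node (s v) (Node (s 0) (left (s (v + 1)))))"
    have s1: "?s1 0 = encode (x, a, e)" using Cons.prems v by simp
    obtain s2 where 2: "runs c ?s1 (T (sz (x, a, e))) s2" "s2 0 = encode (f x a e)"
        "\<And>i. m \<le> i \<Longrightarrow> s2 i = ?s1 i"
      using computesD[OF c, of ?s1 "(x, a, e)", OF s1] by auto
    have "T (sz (x, a, e)) \<le> T (N + K)"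
    proof (rule polynomial_mono[OF T])
      show "sz (x, a, e) \<le> N + K" using Cons.prems(5)[of e] Cons.prems(6) by simp
    qed
    with 2(1) have c2: "runs c ?s1 (T (N + K)) s2" by (rule runs_mono)
    let ?s3 = "s2(v + 1 := right (s2 (v + 1)))"
    have asg: "runs (Assign 0 (NodeE (Var v) (NodeE (Var 0) (LeftE (Var (v + 1)))))) s 7 ?s1"
      "runs (Assign (v + 1) (RightE (Var (v + 1)))) s2 3 ?s3"
      by (auto intro!: runs_Assign_eq)
    have body: "runs body s (T (N + K) + 10) ?s3"
      unfolding body_def
      by (rule runs_mono[OF runs_Seq[OF asg(1) runs_Seq[OF c2 asg(2)]]]) simp
    have "sz (f x a e) + length es * (B + 1) \<le> K"
      using growth[of x a e] Cons.prems(4)[of e] Cons.prems(6) by simp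
    then have "sz (foldl (f x) (f x a e) es) \<le> K \<and>
        (\<exists>s'. runs loop ?s3 (length es * (T (N + K) + 12) + 2) s' \<and>
          s' 0 = encode (foldl (f x) (f x a e) es) \<and> (\<forall>i\<ge>v + 2. s' i = ?s3 i))"
      by (intro Cons.IH) (use Cons.prems 2 v in auto)
    then obtain s' where s': "sz (foldl (f x) (f x a e) es) \<le> K"
        "runs loop ?s3 (length es * (T (N + K) + 12) + 2) s'"
        "s' 0 = encode (foldl (f x) (f x a e) es)" "\<forall>i\<ge>v + 2. s' i = ?s3 i" by blast
    have "runs loop s (length (e # es) * (T (N + K) + 12) + 2) s'"
      unfolding loop_def
      by (rule runs_mono[OF runs_WhileTrue[OF _ body s'(2)[unfolded loop_def]]])
         (use Cons.prems in \<open>auto simp: algebra_simps\<close>)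
    with s' 2 v show ?case by (intro conjI exI[of _ s']) auto
  qed
  define prg where "prg = Seq (Assign v (LeftE (Var 0))) (Seq (Assign (v + 1) (RightE (RightE (Var 0))))
    (Seq (Assign 0 (LeftE (RightE (Var 0)))) loop))"
  \<comment> \<open>The initial accumulator has size at most \<open>n\<close>, and each of at most
    \<open>n\<close> rounds adds at most \<open>R n + 1\<close>.\<close>
  let ?K = "\<lambda>n. n + n * (R n + 1)"
  let ?T = "\<lambda>n. ?K n + (n * (T (n + ?K n) + 12) + 20)"
  let ?h = "\<lambda>z. foldl (f (fst z)) (fst (snd z)) (snd (snd z))"
  have "computes prg (v + 2) ?T ?h"
    unfolding computes_def
  proof (intro allI impI)
    fix s :: state and z :: "'a \<times> 'b \<times> 'e list" assume s: "s 0 = encode z"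
    obtain x a es where z: "z = (x, a, es)" by (cases z)
    let ?n = "sz z"
    let ?s1 = "s(v := left (s 0))"
    let ?s2 = "?s1(v + 1 := right (right (?s1 0)))"
    let ?s3 = "?s2(0 := left (right (?s2 0)))"
    have B: "sz (r x e) \<le> R ?n" if "e \<in> set es" for e
      using computes_sz[OF c', of "(x, e)"] polynomial_mono[OF R, of "sz (x, e)" ?n]
        sz_in_set[OF that] z by simp
    have N: "sz x + sz e + 2 \<le> ?n" if "e \<in> set es" for e
      using sz_in_set[OF that] z by simp
    have "length es * (R ?n + 1) \<le> ?n * (R ?n + 1)"
      by (rule mult_le_mono1) (use length_le_sz[of es] z in simp)
    then have K: "sz a + length es * (R ?n + 1) \<le> ?K ?n" using z by simp
    have "sz (foldl (f x) a es) \<le> ?K ?n \<and>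
      (\<exists>s'. runs loop ?s3 (length es * (T (?n + ?K ?n) + 12) + 2) s' \<and>
        s' 0 = encode (foldl (f x) a es) \<and> (\<forall>i\<ge>v + 2. s' i = ?s3 i))"
      by (rule loop[OF _ _ _ B N K]) (use s z v in auto)
    then obtain s' where s': "sz (foldl (f x) a es) \<le> ?K ?n"
        "runs loop ?s3 (length es * (T (?n + ?K ?n) + 12) + 2) s'"
        "s' 0 = encode (foldl (f x) a es)" "\<forall>i\<ge>v + 2. s' i = ?s3 i" by blast
    have "length es * (T (?n + ?K ?n) + 12) \<le> ?n * (T (?n + ?K ?n) + 12)"
      by (rule mult_le_mono1) (use length_le_sz[of es] z in simp)
    moreover have asg: "runs (Assign v (LeftE (Var 0))) s 3 ?s1"
      "runs (Assign (v + 1) (RightE (RightE (Var 0)))) ?s1 4 ?s2"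
      "runs (Assign 0 (LeftE (RightE (Var 0)))) ?s2 4 ?s3"
      by (auto intro!: runs_Assign_eq)
    ultimately have "runs prg s (?T ?n) s'"
      unfolding prg_def
      by (intro runs_mono[OF runs_Seq[OF asg(1) runs_Seq[OF asg(2) runs_Seq[OF asg(3) s'(2)]]]]) linarith
    moreover have "\<forall>i\<ge>v + 2. s' i = s i" using s'(4) v by auto
    ultimately show "sz (?h z) \<le> ?T ?n \<and>
        (\<exists>s'. runs prg s (?T ?n) s' \<and> s' 0 = encode (?h z) \<and> (\<forall>i\<ge>v + 2. s' i = s i))"
      using s' z by auto
  qed
  moreover have "polynomial ?T"
    by (intro polynomial_intros R polynomial_comp[OF T])
  ultimately have "ptime ?h" by (rule ptimeI[rotated])
  from ptime_comp[OF this ptime_Pair[OF ptime_id ptime_Pair[OF i l]]] show ?thesis by simp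
qed

section \<open>Polynomial-time functions on lists\<close>

lemma ptime_rev [ptime_intros]:
  assumes "ptime (l :: 'a :: enc \<Rightarrow> 'b :: enc list)"
  shows "ptime (\<lambda>x. rev (l x))"
proof -
  have "rev xs = foldl (\<lambda>a e. e # a) [] xs" for xs :: "'b list"
    by (induction xs rule: rev_induct) auto
  moreover have "ptime (\<lambda>x. foldl (\<lambda>a e. e # a) [] (l x))"
    by (rule ptime_foldl[where r = "\<lambda>x e. e"]; (intro ptime_intros assms)?) auto
  ultimately show ?thesis by simp
qed

lemma ptime_append [ptime_intros]:
  assumes "ptime (l :: 'a :: enc \<Rightarrow> 'b :: enc list)" "ptime k"
  shows "ptime (\<lambda>x. l x @ k x)"
proof -
  have "xs @ ys = foldl (\<lambda>a e. e # a) ys (rev xs)" for xs ys :: "'b list"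
    by (induction xs) auto
  moreover have "ptime (\<lambda>x. foldl (\<lambda>a e. e # a) (k x) (rev (l x)))"
    by (rule ptime_foldl[where r = "\<lambda>x e. e"]; (intro ptime_intros assms)?) auto
  ultimately show ?thesis by simp
qed

lemma ptime_map [ptime_intros]:
  fixes g :: "'a :: enc \<Rightarrow> 'b :: enc \<Rightarrow> 'c :: enc"
  assumes "ptime (\<lambda>z. g (fst z) (snd z))" "ptime l"
  shows "ptime (\<lambda>x. map (g x) (l x))"
proof -
  have "map h xs = rev (foldl (\<lambda>a e. h e # a) [] xs)" for h :: "'b \<Rightarrow> 'c" and xs
    by (induction xs rule: rev_induct) auto
  moreover have "ptime (\<lambda>x. foldl (\<lambda>a e. g x e # a) [] (l x))"
    by (rule ptime_foldl[where r = g];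
        (intro ptime_intros assms ptime_comp[OF assms(1), of "\<lambda>z. (fst z, snd (snd z))", simplified])?) auto
  then have "ptime (\<lambda>x. rev (foldl (\<lambda>a e. g x e # a) [] (l x)))" by (rule ptime_rev)
  ultimately show ?thesis by simp
qed

lemma ptime_concat [ptime_intros]:
  assumes "ptime (l :: 'a :: enc \<Rightarrow> 'b :: enc list list)"
  shows "ptime (\<lambda>x. concat (l x))"
proof -
  have "concat xs = foldl (\<lambda>a e. a @ e) [] xs" for xs :: "'b list list"
    by (induction xs rule: rev_induct) auto
  moreover have "ptime (\<lambda>x. foldl (\<lambda>a e. a @ e) [] (l x))"
    by (rule ptime_foldl[where r = "\<lambda>x e. e"]; (intro ptime_intros assms)?) auto
  ultimately show ?thesis by simp
qed

lemma ptime_filter [ptime_intros]: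
  fixes P :: "'a :: enc \<Rightarrow> 'b :: enc \<Rightarrow> bool"
  assumes "ptime (\<lambda>z. P (fst z) (snd z))" "ptime l"
  shows "ptime (\<lambda>x. filter (P x) (l x))"
proof -
  have "filter Q xs = concat (map (\<lambda>e. if Q e then [e] else []) xs)" for Q and xs :: "'b list"
    by (induction xs) auto
  moreover have "ptime (\<lambda>x. concat (map (\<lambda>e. if P x e then [e] else []) (l x)))"
    by (intro ptime_intros assms)
  ultimately show ?thesis by simp
qed

lemma ptime_list_ex [ptime_intros]:
  fixes P :: "'a :: enc \<Rightarrow> 'b :: enc \<Rightarrow> bool"
  assumes "ptime (\<lambda>z. P (fst z) (snd z))" "ptime l"
  shows "ptime (\<lambda>x. list_ex (P x) (l x))"
proof -
  have "list_ex Q xs \<longleftrightarrow> \<not> filter Q xs = []" for Q and xs :: "'b list"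
    by (induction xs) auto
  moreover have "ptime (\<lambda>x. \<not> filter (P x) (l x) = [])"
    by (intro ptime_intros assms)
  ultimately show ?thesis by simp
qed

lemma ptime_list_all [ptime_intros]:
  fixes P :: "'a :: enc \<Rightarrow> 'b :: enc \<Rightarrow> bool"
  assumes "ptime (\<lambda>z. P (fst z) (snd z))" "ptime l"
  shows "ptime (\<lambda>x. list_all (P x) (l x))"
proof -
  have "list_all Q xs \<longleftrightarrow> \<not> list_ex (\<lambda>e. \<not> Q e) xs" for Q and xs :: "'b list"
    by (induction xs) auto
  moreover have "ptime (\<lambda>x. \<not> list_ex (\<lambda>e. \<not> P x e) (l x))"
    by (intro ptime_intros assms)
  ultimately show ?thesis by simp
qed

lemma ptime_replicate_unit [ptime_intros]: "ptime n \<Longrightarrow> ptime (\<lambda>x. replicate (n x) ())"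
  by (erule ptime_encode_cong) (simp add: encode_replicate_unit)

text \<open>Iteration is a fold over a list of units. As the list elements carry no data, the growth
  allowance \<open>r\<close> depends on the fixed argument alone.\<close>

lemma ptime_funpow:
  fixes f :: "'a :: enc \<Rightarrow> 'b :: enc \<Rightarrow> 'b" and r :: "'a \<Rightarrow> 'c :: enc"
  assumes "ptime (\<lambda>z. f (fst z) (snd z))" "ptime i" "ptime n" "ptime r"
    and "\<And>x a. sz (f x a) \<le> sz a + sz (r x) + 1"
  shows "ptime (\<lambda>x. (f x ^^ n x) (i x))"
proof -
  have "(h ^^ k) a = foldl (\<lambda>a _. h a) a (replicate k ())" for h :: "'b \<Rightarrow> 'b" and k a
    by (induction k arbitrary: a) (simp_all add: funpow_Suc_right del: funpow.simps(2))
  moreover have "ptime (\<lambda>x. foldl (\<lambda>a _. f x a) (i x) (replicate (n x) ()))"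
    by (rule ptime_foldl[where r = "\<lambda>x e. r x"];
        (intro ptime_intros assms ptime_comp[OF assms(1), of "\<lambda>z. (fst z, fst (snd z))", simplified]
          ptime_comp[OF assms(4)])?)
  ultimately show ?thesis by simp
qed

section \<open>Arithmetic on unary numbers\<close>

lemma ptime_Suc [ptime_intros]: "ptime f \<Longrightarrow> ptime (\<lambda>x. Suc (f x))"
  by (erule ptime_comp[rotated], rule ptime_expr[of "NodeE LeafE (Var 0)" _ 1]) auto

lemma encode_pred: "encode (n - 1 :: nat) = right (encode n)"
  by (cases n) auto

lemma ptime_pred: "ptime f \<Longrightarrow> ptime (\<lambda>x. f x - 1 :: nat)"
  by (erule ptime_comp[rotated], rule ptime_expr[of "RightE (Var 0)" _ 0])
     (simp_all add: encode_pred[symmetric] del: One_nat_def)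

text \<open>Truncated subtraction is the iterated predecessor. Vanishing of the differences in both
  directions later decides equality.\<close>

lemma ptime_diff [ptime_intros]:
  assumes "ptime f" "ptime g"
  shows "ptime (\<lambda>x. f x - g x :: nat)"
proof -
  have *: "((\<lambda>k. k - 1) ^^ n) m = m - n" for m n :: nat
    by (induction n) auto
  have "ptime (\<lambda>x. ((\<lambda>k. k - 1) ^^ g x) (f x))"
    by (rule ptime_funpow[where r = "\<lambda>x. ()"]; (intro ptime_intros ptime_pred assms)?) auto
  then show ?thesis by (simp only: *)
qed

lemma ptime_nat_eq_0: "ptime f \<Longrightarrow> ptime (\<lambda>x. f x = (0 :: nat))"
  using ptime_is_Nil[OF ptime_replicate_unit, of f] by simp

lemma ptime_nat_eq [ptime_intros]:
  assumes "ptime f" "ptime g"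
  shows "ptime (\<lambda>x. f x = (g x :: nat))"
proof -
  have "(\<lambda>x. f x = g x) = (\<lambda>x. f x - g x = 0 \<and> g x - f x = 0)" by auto
  then show ?thesis by (simp only:) (intro ptime_intros ptime_nat_eq_0 assms)
qed

lemma ptime_member [ptime_intros]:
  assumes "ptime f" "ptime l"
  shows "ptime (\<lambda>x. (f x :: nat) \<in> set (l x))"
proof -
  have "(\<lambda>x. f x \<in> set (l x)) = (\<lambda>x. list_ex (\<lambda>e. e = f x) (l x))"
    by (auto simp: list_ex_iff)
  then show ?thesis by (simp only:) (intro ptime_intros assms ptime_comp[OF assms(1)])
qed

lemma ptime_subset [ptime_intros]:
  assumes "ptime k" "ptime l"
  shows "ptime (\<lambda>x. set (k x :: nat list) \<subseteq> set (l x))"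
proof -
  have "(\<lambda>x. set (k x) \<subseteq> set (l x)) = (\<lambda>x. list_all (\<lambda>e. e \<in> set (l x)) (k x))"
    by (auto simp: list_all_iff)
  then show ?thesis by (simp only:) (intro ptime_intros assms ptime_comp[OF assms(2)])
qed

lemma ptime_length [ptime_intros]:
  assumes "ptime l"
  shows "ptime (\<lambda>x. length (l x))"
proof -
  have "length xs = foldl (\<lambda>a _. Suc a) 0 xs" for xs :: "'b list"
    by (induction xs rule: rev_induct) auto
  moreover have "ptime (\<lambda>x. foldl (\<lambda>a _. Suc a) 0 (l x))"
    by (rule ptime_foldl[where r = "\<lambda>x e. ()"]; (intro ptime_intros assms)?) auto
  ultimately show ?thesis by simp
qed

text \<open>
  The detour through \<^term>\<open>n - (n - length a)\<close>, which is \<^term>\<open>length a\<close> as long as the loop runs,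
  makes the growth of the accumulator bounded for arbitrary values of it.
\<close>

lemma ptime_upt [ptime_intros]:
  assumes "ptime n"
  shows "ptime (\<lambda>x. [0..<n x])"
proof -
  have *: "((\<lambda>a. (n - (n - length a)) # a) ^^ k) [] = rev [0..<k]" if "k \<le> n" for n k :: nat
    using that by (induction k) auto
  have "ptime (\<lambda>x. rev (((\<lambda>a. (n x - (n x - length a)) # a) ^^ n x) []))"
    by (rule ptime_rev, rule ptime_funpow[where r = n];
        (intro ptime_intros assms ptime_comp[OF assms])?) auto
  then show ?thesis by (simp add: *)
qed

lemma ptime_drop [ptime_intros]:
  assumes "ptime n" "ptime l"
  shows "ptime (\<lambda>x. drop (n x) (l x))"
proof -
  have "drop n xs = (tl ^^ n) xs" for n and xs :: "'b list"
    by (induction n arbitrary: xs) (auto simp: drop_Suc funpow_swap1 tl_drop)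
  moreover have "ptime (\<lambda>x. (tl ^^ n x) (l x))"
    by (rule ptime_funpow[where r = "\<lambda>x. ()"]; (intro ptime_intros assms)?)
       (auto simp: encode_tl intro: le_SucI size_right)
  ultimately show ?thesis by simp
qed

lemma ptime_take [ptime_intros]:
  assumes "ptime n" "ptime l"
  shows "ptime (\<lambda>x. take (n x) (l x))"
proof -
  have "take n xs = rev (drop (length xs - n) (rev xs))" for n and xs :: "'b list"
    by (cases "n \<le> length xs") (auto simp: rev_drop)
  then show ?thesis by (simp only:) (intro ptime_intros assms)
qed

text \<open>The program computes \<open>z0\<close>, then outputs the head of the first component and
  applies \<open>nx\<close> until that component is empty. Iterating a polynomial-time step may
  produce states of superpolynomial size, hence the separate bound \<open>Q\<close> on the reached
  states. Program and time bound are chosen before the instance \<open>x\<close> and the number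
  \<open>N\<close> of outputs.\<close>

lemma exec_enumeration:
  fixes z0 :: "'i :: enc \<Rightarrow> 'o :: enc list \<times> 's :: enc"
    and nx :: "'o list \<times> 's \<Rightarrow> 'o list \<times> 's"
  assumes "ptime z0" "ptime nx" and Q: "polynomial Q"
  shows "\<exists>c p. polynomial p \<and> (\<forall>x N.
    (\<forall>k<N. fst ((nx ^^ k) (z0 x)) \<noteq> []) \<and> fst ((nx ^^ N) (z0 x)) = [] \<and>
    (\<forall>k\<le>N. sz ((nx ^^ k) (z0 x)) \<le> Q (sz x + k)) \<longrightarrow>
    (\<exists>t out s'. exec c (initial_state (encode x)) t out s' \<and>
      map snd out = map (\<lambda>k. encode (hd (fst ((nx ^^ k) (z0 x))))) [0..<N] \<and>
      (\<forall>i<N. fst (out ! i) \<le> p (sz x + Suc i)) \<and> t \<le> p (sz x + N)))"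
proof -
  obtain c0 m0 T0 where T0: "polynomial T0" and c0: "computes c0 m0 T0 z0"
    using assms(1) by (auto simp: ptime_def)
  obtain c1 m1 T1 where T1: "polynomial T1" and c1: "computes c1 m1 T1 nx"
    using assms(2) by (auto simp: ptime_def)
  define body where "body = Seq (Output (LeftE (LeftE (Var 0)))) c1"
  define loop where "loop = While (LeftE (Var 0)) body"
  \<comment> \<open>Cost of one round: 3 for the loop test, 4 plus the size of the tree for the
    output, and the time of \<open>c1\<close>.\<close>
  define U where "U = (\<lambda>m. 7 + Q m + T1 (Q m))"
  have U: "polynomial U" unfolding U_def by (intro polynomial_intros Q polynomial_comp[OF T1])
  \<comment> \<open>Since \<open>U\<close> is monotone, the first \<open>i + 1\<close> rounds from
    \<open>k\<close> on together cost at most \<open>i + 1\<close> times the bound for the last of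
    them.\<close>
  have loop: "\<exists>t out s'. exec loop s t out s' \<and>
      map snd out = map (\<lambda>i. encode (hd (fst ((nx ^^ i) z)))) [k..<N] \<and>
      (\<forall>i<N - k. fst (out ! i) \<le> Suc i * U (n + (k + i))) \<and> t \<le> Suc (N - k) * U (n + N)"
    if "s 0 = encode ((nx ^^ k) z)" "k \<le> N"
      "\<And>i. i < N \<Longrightarrow> fst ((nx ^^ i) z) \<noteq> []" "fst ((nx ^^ N) z) = []"
      "\<And>i. i \<le> N \<Longrightarrow> sz ((nx ^^ i) z) \<le> Q (n + i)" for s k N n and z :: "'o list \<times> 's"
    using that
  proof (induction "N - k" arbitrary: s k)
    case 0
    then have "k = N" by simp
    with 0 have "left (s 0) = Leaf" by (simp add: encode_prod_def)
    then have "exec loop s 3 [] s"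
      unfolding loop_def using exec.WhileFalse[of "LeftE (Var 0)" s body] by (simp add: numeral_eq_Suc)
    moreover have "3 \<le> U (n + N)" by (simp add: U_def)
    ultimately show ?case using \<open>k = N\<close> by (intro exI[of _ 3] exI[of _ "[]"] exI[of _ s]) simp
  next
    case (Suc d)
    let ?z = "(nx ^^ k) z"
    have k: "k < N" using Suc by simp
    with Suc.prems obtain y ys where y: "fst ?z = y # ys" by (metis list.exhaust)
    define v where "v = encode y"
    have s: "left (s 0) \<noteq> Leaf" "left (left (s 0)) = v"
      using Suc.prems(1) y by (simp_all add: encode_prod_def v_def)
    have "size v \<le> sz ?z" using y by (simp add: encode_prod_def v_def)
    moreover have Qk: "sz ?z \<le> Q (n + k)" using Suc.prems k by simp
    ultimately have v: "size v \<le> Q (n + k)" by simp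
    define t1 where "t1 = size v + 4"
    have out: "exec (Output (LeftE (LeftE (Var 0)))) s t1 [(t1, v)] s"
      using exec.Output[of t1 "LeftE (LeftE (Var 0))" s] s by (simp add: t1_def)
    obtain s1 where s1: "runs c1 s (T1 (sz ?z)) s1" "s1 0 = encode (nx ?z)"
      using computesD[OF c1, of s ?z, OF Suc.prems(1)] by blast
    then obtain t2 where t2: "t2 \<le> T1 (sz ?z)" "exec c1 s t2 [] s1" unfolding runs_def by blast
    have body: "exec body s (t1 + t2) [(t1, v)] s1"
      unfolding body_def using exec.Seq[OF out t2(2)] by simp
    have t2': "t2 \<le> T1 (Q (n + k))" using t2(1) polynomial_mono[OF T1 Qk] by simp
    have mono: "U (n + i) \<le> U (n + j)" if "i \<le> j" for i j
      using polynomial_mono[OF U] that by simp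
    have Uk: "3 + t1 + t2 \<le> U (n + k)" using v t2' by (simp add: U_def t1_def)
    have "d = N - Suc k" "s1 0 = encode ((nx ^^ Suc k) z)" "Suc k \<le> N"
      using Suc.hyps(2) s1 k by simp_all
    from Suc.hyps(1)[of "Suc k" s1, OF this Suc.prems(3-5)] obtain t out s'
      where IH: "exec loop s1 t out s'"
        "map snd out = map (\<lambda>i. encode (hd (fst ((nx ^^ i) z)))) [Suc k..<N]"
        "\<forall>i<N - Suc k. fst (out ! i) \<le> Suc i * U (n + (Suc k + i))"
        "t \<le> Suc (N - Suc k) * U (n + N)"
      by blast
    let ?out = "(3 + t1, v) # delay (3 + (t1 + t2)) out"
    have "expr_value (LeftE (Var 0)) s \<noteq> Leaf" "3 = expr_cost (LeftE (Var 0)) + 1"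
      using s by auto
    from exec.WhileTrue[OF this body IH(1)[unfolded loop_def]]
    have "exec loop s (3 + (t1 + t2) + t) ?out s'"
      unfolding loop_def by (simp add: delay_def)
    moreover have "map snd ?out = map (\<lambda>i. encode (hd (fst ((nx ^^ i) z)))) [k..<N]"
      using IH(2) k y by (simp add: delay_def comp_def case_prod_beta upt_conv_Cons v_def)
    moreover have "fst (?out ! i) \<le> Suc i * U (n + (k + i))" if "i < N - k" for i
    proof (cases i)
      case 0
      then show ?thesis using Uk by simp
    next
      case (Suc j)
      with that have j: "j < N - Suc k" by simp
      moreover have "length out = N - Suc k" using arg_cong[OF IH(2), of length] by simp
      ultimately have "fst (?out ! i) = 3 + (t1 + t2) + fst (out ! j)"
        using Suc by (simp add: delay_def case_prod_beta)
      also have "\<dots> \<le> U (n + k) + Suc j * U (n + (Suc k + j))"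
        using Uk IH(3) j by (intro add_mono) auto
      also have "\<dots> \<le> U (n + (k + i)) + Suc j * U (n + (k + i))"
        using mono[of k "k + i"] Suc by (intro add_mono) auto
      finally show ?thesis using Suc by simp
    qed
    moreover have "3 + (t1 + t2) + t \<le> Suc (N - k) * U (n + N)"
    proof -
      have "3 + (t1 + t2) + t \<le> U (n + N) + Suc (N - Suc k) * U (n + N)"
        using Uk mono[of k N] k IH(4) by (intro add_mono) auto
      also have "\<dots> = Suc (N - k) * U (n + N)" using k by (simp flip: Suc_diff_Suc)
      finally show ?thesis .
    qed
    ultimately show ?case by blast
  qed
  define p where "p = (\<lambda>m. T0 m + (m + 1) * U m)"
  have p: "polynomial p" unfolding p_def by (intro polynomial_intros T0 U)
  have "\<exists>t out s'. exec (Seq c0 loop) (initial_state (encode x)) t out s' \<and>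
      map snd out = map (\<lambda>k. encode (hd (fst ((nx ^^ k) (z0 x))))) [0..<N] \<and>
      (\<forall>i<N. fst (out ! i) \<le> p (sz x + Suc i)) \<and> t \<le> p (sz x + N)"
    if N: "\<forall>k<N. fst ((nx ^^ k) (z0 x)) \<noteq> []" "fst ((nx ^^ N) (z0 x)) = []"
      "\<forall>k\<le>N. sz ((nx ^^ k) (z0 x)) \<le> Q (sz x + k)" for x N
  proof -
    have "initial_state (encode x) 0 = encode x" by (simp add: initial_state_def)
    from computesD[OF c0, of "initial_state (encode x)" x, OF this] obtain s0
      where "runs c0 (initial_state (encode x)) (T0 (sz x)) s0" and s0: "s0 0 = encode (z0 x)" by blast
    then obtain t0 where t0: "t0 \<le> T0 (sz x)" "exec c0 (initial_state (encode x)) t0 [] s0"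
      unfolding runs_def by blast
    have "s0 0 = encode ((nx ^^ 0) (z0 x))" using s0 by simp
    from loop[of s0 0 "z0 x" N "sz x", OF this] N obtain t out s' where l: "exec loop s0 t out s'"
      "map snd out = map (\<lambda>i. encode (hd (fst ((nx ^^ i) (z0 x))))) [0..<N]"
      "\<forall>i<N. fst (out ! i) \<le> Suc i * U (sz x + i)" "t \<le> Suc N * U (sz x + N)"
      by auto
    have "exec (Seq c0 loop) (initial_state (encode x)) (t0 + t) (delay t0 out) s'"
      using exec.Seq[OF t0(2) l(1)] by simp
    moreover have "map snd (delay t0 out) = map snd out" by (simp add: delay_def case_prod_beta comp_def)
    moreover have "fst (delay t0 out ! i) \<le> p (sz x + Suc i)" if "i < N" for i
    proof -
      have "length out = N" using arg_cong[OF l(2), of length] by simp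
      then have "fst (delay t0 out ! i) = t0 + fst (out ! i)"
        using that by (simp add: delay_def case_prod_beta)
      also have "\<dots> \<le> T0 (sz x + Suc i) + (sz x + Suc i + 1) * U (sz x + Suc i)"
      proof (intro add_mono)
        show "t0 \<le> T0 (sz x + Suc i)"
          using t0(1) polynomial_mono[OF T0, of "sz x" "sz x + Suc i"] by simp
        have "fst (out ! i) \<le> Suc i * U (sz x + i)" using l(3) that by blast
        also have "\<dots> \<le> (sz x + Suc i + 1) * U (sz x + Suc i)"
          by (intro mult_mono polynomial_mono[OF U]) auto
        finally show "fst (out ! i) \<le> (sz x + Suc i + 1) * U (sz x + Suc i)" .
      qed
      finally show ?thesis by (simp only: p_def)
    qed
    moreover have "t0 + t \<le> p (sz x + N)"
      unfolding p_def
    proof (intro add_mono)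
      show "t0 \<le> T0 (sz x + N)"
        using t0(1) polynomial_mono[OF T0, of "sz x" "sz x + N"] by simp
      show "t \<le> (sz x + N + 1) * U (sz x + N)"
        by (rule order_trans[OF l(4)]) (intro mult_mono, auto)
    qed
    ultimately show ?thesis
      using l(2) by (intro exI[of _ "t0 + t"] exI[of _ "delay t0 out"] exI[of _ s']) simp
  qed
  with p show ?thesis by blast
qed

section \<open>Chordal bipartite graphs\<close>

locale chordal_bipartite_graph =
  fixes G :: "'a pair_pre_digraph" and A B :: "'a set"
  assumes pair_graph: "pair_graph G"
    and sides: "A \<union> B = pverts G" "A \<inter> B = {}" "parcs G \<subseteq> A \<times> B \<union> B \<times> A"
    and no_induced_cycle: "\<nexists>p. induced_cycle G p \<and> length p > 4"
begin

abbreviation "V \<equiv> pverts G"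
abbreviation "E \<equiv> parcs G"

interpretation pair_graph G by (rule pair_graph)

lemma finite_V: "finite V"
  by (rule pair_finite_verts)

lemma E_sym: "(u, v) \<in> E \<Longrightarrow> (v, u) \<in> E"
  by (rule arcs_symmetric)

lemma not_E_sym: "(u, v) \<notin> E \<Longrightarrow> (v, u) \<notin> E"
  using E_sym by blast

lemma converse_subset_E: "R \<subseteq> E \<Longrightarrow> R\<inverse> \<subseteq> E"
  using E_sym by auto

lemma E_V: "(u, v) \<in> E \<Longrightarrow> u \<in> V \<and> v \<in> V"
  using in_arcsD1 in_arcsD2 by blast

lemma E_loopfree: "(u, u) \<notin> E"
  using no_loops' by blast

lemma side_independent: "S \<in> {A, B} \<Longrightarrow> u \<in> S \<Longrightarrow> v \<in> S \<Longrightarrow> (u, v) \<notin> E"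
  using sides by blast

lemma no_triangle: "(u, v) \<in> E \<Longrightarrow> (u, w) \<in> E \<Longrightarrow> (v, w) \<notin> E"
  using sides by blast

lemma rtrancl_E_sym: "(u, v) \<in> (E \<inter> D \<times> D)\<^sup>* \<Longrightarrow> (v, u) \<in> (E \<inter> D \<times> D)\<^sup>*"
  by (rule symD[OF sym_rtrancl]) (auto simp: sym_def intro: E_sym)

text \<open>Connectivity is defined through the symmetric closure, which adds nothing here because
  arcs come in opposite pairs. Nonemptiness is part of strong connectivity.\<close>

lemma connected_induce_iff:
  "connected (with_proj G \<restriction> D) \<longleftrightarrow>
     D \<noteq> {} \<and> (\<forall>u\<in>D. \<forall>v\<in>D. (u, v) \<in> (E \<inter> D \<times> D)\<^sup>*)"
proof -
  let ?H = "mk_symmetric (with_proj G \<restriction> D)"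
  have verts: "pverts ?H = D" by (simp add: mk_symmetric_def)
  have arcs: "parcs ?H = E \<inter> D \<times> D"
    unfolding mk_symmetric_def by (auto simp: induce_subgraph_def intro: E_sym)
  have "u \<rightarrow>\<^sup>*\<^bsub>with_proj ?H\<^esub> v \<longleftrightarrow> (u, v) \<in> (E \<inter> D \<times> D)\<^sup>*" if "u \<in> D" "v \<in> D" for u v
  proof
    assume "u \<rightarrow>\<^sup>*\<^bsub>with_proj ?H\<^esub> v"
    then show "(u, v) \<in> (E \<inter> D \<times> D)\<^sup>*"
      unfolding reachable_def by (auto simp: arcs dest: rtrancl_on_rtranclI)
  next
    assume "(u, v) \<in> (E \<inter> D \<times> D)\<^sup>*"
    then show "u \<rightarrow>\<^sup>*\<^bsub>with_proj ?H\<^esub> v"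
      unfolding reachable_def with_proj_simps verts arcs
      by (rule rtrancl_consistent_rtrancl_on) (use that in auto)
  qed
  then show ?thesis
    unfolding connected_def strongly_connected_def by (auto simp: verts)
qed

lemma cds_iff:
  "connected_dominating_set G D \<longleftrightarrow> D \<subseteq> V \<and> (\<forall>v\<in>V - D. \<exists>u\<in>D. (u, v) \<in> E) \<and>
     D \<noteq> {} \<and> (\<forall>u\<in>D. \<forall>v\<in>D. (u, v) \<in> (E \<inter> D \<times> D)\<^sup>*)"
  unfolding connected_dominating_set_def dominating_set_def connected_induce_iff by auto

text \<open>Domination attaches each added vertex directly to the connected set \<open>D\<close>.
  Because of this upward closure, minimality and maximality can be tested with single
  vertices.\<close>

lemma cds_mono:
  assumes D: "connected_dominating_set G D" and "D \<subseteq> D'" "D' \<subseteq> V"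
  shows "connected_dominating_set G D'"
  unfolding cds_iff
proof (intro conjI ballI)
  show "D' \<subseteq> V" "D' \<noteq> {}" using assms by (auto simp: cds_iff)
  show "\<exists>u\<in>D'. (u, v) \<in> E" if "v \<in> V - D'" for v
    using assms that unfolding cds_iff by blast
  obtain d where d: "d \<in> D" using D by (auto simp: cds_iff)
  have mono: "(E \<inter> D \<times> D)\<^sup>* \<subseteq> (E \<inter> D' \<times> D')\<^sup>*"
    using assms by (intro rtrancl_mono) auto
  have to_d: "(d, v) \<in> (E \<inter> D' \<times> D')\<^sup>*" if v: "v \<in> D'" for v
  proof (cases "v \<in> D")
    case True
    then show ?thesis using D d mono unfolding cds_iff by blast
  next
    case False
    then obtain u where "u \<in> D" "(u, v) \<in> E" using v assms unfolding cds_iff by blast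
    moreover from this have "(d, u) \<in> (E \<inter> D' \<times> D')\<^sup>*"
      using D d mono unfolding cds_iff by blast
    ultimately show ?thesis using v assms(2) by (blast intro: rtrancl_into_rtrancl)
  qed
  show "(u, v) \<in> (E \<inter> D' \<times> D')\<^sup>*" if "u \<in> D'" "v \<in> D'" for u v
    using to_d[OF that(1)] to_d[OF that(2)] by (blast intro: rtrancl_E_sym rtrancl_trans)
qed

text \<open>Passes from vertex lists to the arc lists of the definition:
  \<open>zip vs (rotate1 vs)\<close> lists the arcs of the closed walk through \<open>vs\<close>,
  and the last hypothesis excludes chords.\<close>

lemma no_long_induced_cycle:
  assumes "distinct vs" "length vs > 4" "set (zip vs (rotate1 vs)) \<subseteq> E"
    and "E \<inter> set vs \<times> set vs \<subseteq> set (zip vs (rotate1 vs)) \<union> (set (zip vs (rotate1 vs)))\<inverse>"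
  shows False
proof -
  obtain v ws where vs: "vs = v # ws" using assms(2) by (cases vs) auto
  define p where "p = zip vs (rotate1 vs)"
  have verts: "pawalk_verts u (zip (u # ws) (ws @ [w])) = u # ws @ [w]" for u w
    by (induction ws arbitrary: u) auto
  have cas: "pcas u (zip (u # ws) (ws @ [w])) w" for u w
    by (induction ws arbitrary: u) auto
  have "v \<in> V"
    using assms(2,3) E_V by (cases ws) (auto simp: vs)
  then have "awalk v p v"
    unfolding awalk_def using assms(3) cas[of v v] by (simp add: p_def vs)
  moreover have "distinct (tl (pawalk_verts v p))"
    using assms(1) verts[of v v] by (simp add: p_def vs)
  moreover have "p \<noteq> []" using assms(2) by (simp add: p_def vs)
  ultimately have "cycle p" unfolding cycle_def by blast
  moreover have "fst ` set p = set vs"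
    unfolding p_def set_map[symmetric] by simp
  then have "arcs (with_proj G \<restriction> (fst ` set p)) \<subseteq> set p \<union> (set p)\<inverse>"
    using assms(4) by (auto simp: induce_subgraph_def p_def)
  ultimately have "induced_cycle G p" unfolding induced_cycle_def by blast
  moreover have "length p > 4" using assms(2) by (simp add: p_def)
  ultimately show False using no_induced_cycle by blast
qed

text \<open>Each \<open>xi\<close> misses only the opposite vertex \<open>yi\<close> of the hexagon,
  and the sides exclude all other chords. The adjacency pattern also forces the six vertices to be
  distinct.\<close>

lemma no_induced_hexagon:
  assumes S: "S \<in> {A, B}" "x1 \<in> S" "x2 \<in> S" "x3 \<in> S"
    and e: "(x2, y1) \<in> E" "(x3, y1) \<in> E" "(x1, y2) \<in> E" "(x3, y2) \<in> E" "(x1, y3) \<in> E" "(x2, y3) \<in> E"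
    and n: "(x1, y1) \<notin> E" "(x2, y2) \<notin> E" "(x3, y3) \<notin> E"
  shows False
proof (rule no_long_induced_cycle)
  let ?vs = "[x1, y2, x3, y1, x2, y3]"
  note sym = e[THEN E_sym]
  have y: "y1 \<notin> S" "y2 \<notin> S" "y3 \<notin> S"
    using side_independent[OF S(1)] S(2-4) e by blast+
  show "distinct ?vs" using y S e n by auto
  show "length ?vs > 4" by simp
  show "set (zip ?vs (rotate1 ?vs)) \<subseteq> E" using e sym by simp
  have nonadjacent: "(x1, x2) \<notin> E" "(x1, x3) \<notin> E" "(x2, x3) \<notin> E"
      "(y1, y2) \<notin> E" "(y1, y3) \<notin> E" "(y2, y3) \<notin> E"
    by (fact side_independent[OF S(1,2,3)] side_independent[OF S(1,2,4)] side_independent[OF S(1,3,4)]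
      no_triangle[OF e(2,4)] no_triangle[OF e(1,6)] no_triangle[OF e(3,5)])+
  note simps = nonadjacent nonadjacent[THEN not_E_sym] n n[THEN not_E_sym] E_loopfree
  show "E \<inter> set ?vs \<times> set ?vs \<subseteq> set (zip ?vs (rotate1 ?vs)) \<union> (set (zip ?vs (rotate1 ?vs)))\<inverse>"
  proof (rule subrelI)
    fix u v assume "(u, v) \<in> E \<inter> set ?vs \<times> set ?vs"
    then have "(u, v) \<in> E" "u \<in> set ?vs" "v \<in> set ?vs" by auto
    then show "(u, v) \<in> set (zip ?vs (rotate1 ?vs)) \<union> (set (zip ?vs (rotate1 ?vs)))\<inverse>"
      unfolding list.set insert_iff by (elim disjE) (simp_all add: simps)
  qed
qed

text \<open>
  A minimal subset with the same common neighbours has at most two elements, because private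
  non-neighbours of three elements would complete an induced 6-cycle.
\<close>

lemma common_neighbours_of_pair:
  assumes S: "S \<in> {A, B}" and X: "X \<subseteq> S" "X \<noteq> {}"
  shows "\<exists>p\<in>X. \<exists>q\<in>X. \<forall>y. (p, y) \<in> E \<longrightarrow> (q, y) \<in> E \<longrightarrow> (\<forall>x\<in>X. (x, y) \<in> E)"
proof -
  define N where "N = (\<lambda>Y. {y. \<forall>x\<in>Y. (x, y) \<in> E})"
  define P where "P = (\<lambda>Y. Y \<subseteq> X \<and> Y \<noteq> {} \<and> N Y \<subseteq> N X)"
  have "P X" using X by (simp add: P_def)
  then obtain Y where Y: "P Y" and least: "\<And>Z. P Z \<Longrightarrow> card Y \<le> card Z"
    using ex_has_least_nat[of P X card] by blast
  have "finite X" using X S sides finite_V by (metis finite_Un finite_subset insertE singletonD)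
  then have fin: "finite Y" using Y by (auto simp: P_def intro: finite_subset)
  have "card Y \<le> 2"
  proof (rule ccontr)
    assume "\<not> card Y \<le> 2"
    then have "3 \<le> card Y" by simp
    then obtain Z where Z: "Z \<subseteq> Y" "card Z = 3" by (meson obtain_subset_with_card_n)
    then obtain x1 x2 x3 where x: "Z = {x1, x2, x3}" "x1 \<noteq> x2" "x2 \<noteq> x3" "x1 \<noteq> x3"
      by (auto simp: card_3_iff)
    have "\<exists>y. y \<in> N (Y - {x}) \<and> (x, y) \<notin> E" if "x \<in> Z" for x
    proof -
      have "card (Y - {x}) < card Y" using that Z fin by (intro psubset_card_mono) auto
      then have "\<not> P (Y - {x})" using least by (meson not_le)
      moreover have "Y - {x} \<noteq> {}" using Z x that by auto
      ultimately have "\<not> N (Y - {x}) \<subseteq> N X" using Y by (auto simp: P_def)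
      then obtain y where y: "y \<in> N (Y - {x})" "y \<notin> N Y" using Y unfolding P_def by blast
      then have "(x, y) \<notin> E" unfolding N_def by blast
      with y show ?thesis by blast
    qed
    then obtain f where f: "\<And>x. x \<in> Z \<Longrightarrow> f x \<in> N (Y - {x}) \<and> (x, f x) \<notin> E" by metis
    have inS: "x1 \<in> S" "x2 \<in> S" "x3 \<in> S" using x Z Y X by (auto simp: P_def)
    show False
      by (rule no_induced_hexagon[OF S inS, of "f x1" "f x2" "f x3"])
         (use f[of x1] f[of x2] f[of x3] x Z in \<open>auto simp: N_def\<close>)
  qed
  moreover have "card Y \<noteq> 0" using Y fin by (auto simp: P_def)
  ultimately have "card Y = 1 \<or> card Y = 2" by linarith
  \<comment> \<open>The vertices \<open>p\<close> and \<open>q\<close> coincide if \<open>Y\<close>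
    has a single element.\<close>
  then obtain p q where "Y = {p, q}" by (auto simp: card_1_singleton_iff card_2_iff)
  with Y show ?thesis
    by (intro bexI[of _ p] bexI[of _ q]) (auto simp: P_def N_def)
qed

text \<open>Walks from \<open>p\<close> to \<open>q\<close> are represented by the list of their inner vertices.\<close>

definition walk_via :: "'a set \<Rightarrow> 'a \<Rightarrow> 'a \<Rightarrow> 'a list \<Rightarrow> bool" where
  "walk_via C p q ws \<longleftrightarrow> set ws \<subseteq> C \<and> successively (\<lambda>u v. (u, v) \<in> E) (p # ws @ [q])"

section \<open>Chordless walks through a vertex set\<close>

lemma successively_E_conv_zip:
  "successively (\<lambda>u v. (u, v) \<in> E) (p # ws @ [q]) \<longleftrightarrow> set (zip (p # ws) (ws @ [q])) \<subseteq> E"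
  by (induction ws arbitrary: p) auto

lemma walk_via_exists:
  assumes "(p, c) \<in> E" "c \<in> C" "(c, d) \<in> (E \<inter> C \<times> C)\<^sup>*" "(d, q) \<in> E"
  shows "\<exists>ws. walk_via C p q ws"
proof -
  have "\<exists>ws. set (ws @ [d]) \<subseteq> C \<and> successively (\<lambda>u v. (u, v) \<in> E) (p # ws @ [d])"
    using assms(3)
  proof (induction rule: rtrancl_induct)
    case base
    show ?case using assms(1,2) by (intro exI[of _ "[]"]) auto
  next
    case (step d e)
    then obtain ws where "set (ws @ [d]) \<subseteq> C" "successively (\<lambda>u v. (u, v) \<in> E) (p # ws @ [d])" by blast
    with step(2) show ?case
      by (intro exI[of _ "ws @ [d]"]) (auto simp: successively_append_iff successively_Cons hd_append)
  qed
  then obtain ws where "set (ws @ [d]) \<subseteq> C" "successively (\<lambda>u v. (u, v) \<in> E) (p # ws @ [d])" by blast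
  with assms(4) show ?thesis unfolding walk_via_def
    by (intro exI[of _ "ws @ [d]"]) (auto simp: successively_append_iff successively_Cons hd_append)
qed

text \<open>Serves to jump along a chord and also to cut out a closed subwalk, where the arc into
  the first occurrence of a vertex is redirected to a later one.\<close>

lemma shortcut:
  assumes "successively R xs" "i < length xs" "j < length xs" "R (xs ! i) (xs ! j)"
  shows "successively R (take (Suc i) xs @ drop j xs)"
proof -
  have "successively R (take (Suc i) xs)" "successively R (drop j xs)"
    using assms(1) by (metis append_take_drop_id successively_append_iff)+
  moreover have "last (take (Suc i) xs) = xs ! i" using assms(2) by (simp add: take_Suc_conv_app_nth)
  ultimately show ?thesis
    using assms by (auto simp: successively_append_iff hd_drop_conv_nth)
qed

text \<open>Take a walk with the fewest inner vertices: a chord or a repeated vertex would allow a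
  shortcut.\<close>

lemma shortest_walk:
  assumes "walk_via C p q ws0" "p \<noteq> q" "p \<notin> C" "q \<notin> C"
  shows "\<exists>ws. walk_via C p q ws \<and> distinct (p # ws @ [q]) \<and>
    E \<inter> set (p # ws @ [q]) \<times> set (p # ws @ [q]) \<subseteq>
      set (zip (p # ws) (ws @ [q])) \<union> (set (zip (p # ws) (ws @ [q])))\<inverse>"
proof -
  let ?R = "\<lambda>u v. (u, v) \<in> E"
  obtain ws where ws: "walk_via C p q ws"
    and least: "\<And>vs. walk_via C p q vs \<Longrightarrow> length ws \<le> length vs"
    using ex_has_least_nat[of "walk_via C p q" ws0 length] assms(1) by blast
  let ?xs = "p # ws @ [q]"
  have xs: "successively ?R ?xs" and C: "set ws \<subseteq> C" using ws by (auto simp: walk_via_def)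
  have chord: "j \<le> Suc i" if "i < j" "j < length ?xs" "?R (?xs ! i) (?xs ! j)" for i j
  proof (rule ccontr)
    assume "\<not> j \<le> Suc i"
    then obtain k where k: "j = Suc k" "i < k" by (cases j) auto
    let ?vs = "take i ws @ drop k ws"
    have "take (Suc i) ?xs @ drop j ?xs = p # ?vs @ [q]" using that k by simp
    then have "successively ?R (p # ?vs @ [q])" using shortcut[OF xs, of i j] that by simp
    then have "walk_via C p q ?vs"
      using C unfolding walk_via_def by (auto dest: in_set_takeD in_set_dropD)
    from least[OF this] show False using that k by simp
  qed
  have "distinct ws"
  proof (rule ccontr)
    assume "\<not> distinct ws"
    then obtain i j where ij: "i < j" "j < length ws" "ws ! i = ws ! j"
      by (metis distinct_conv_nth linorder_neqE_nat)
    \<comment> \<open>As \<open>p\<close> is at position 0 of \<open>?xs\<close>, the two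
      occurrences have positions \<open>Suc i\<close> and \<open>Suc j\<close> there.\<close>
    let ?vs = "take i ws @ drop j ws"
    have "?R (?xs ! i) (?xs ! Suc i)"
      using xs ij by (auto simp: successively_conv_nth)
    moreover have "?xs ! Suc i = ?xs ! Suc j" using ij by (simp add: nth_append)
    ultimately have "successively ?R (take (Suc i) ?xs @ drop (Suc j) ?xs)"
      using ij by (intro shortcut[OF xs]) auto
    moreover have "take (Suc i) ?xs @ drop (Suc j) ?xs = p # ?vs @ [q]" using ij by simp
    ultimately have "walk_via C p q ?vs"
      using C unfolding walk_via_def by (auto dest: in_set_takeD in_set_dropD)
    from least[OF this] show False using ij by simp
  qed
  then have "distinct ?xs" using assms C by auto
  moreover have "(u, v) \<in> set (zip (p # ws) (ws @ [q])) \<union> (set (zip (p # ws) (ws @ [q])))\<inverse>"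
    if uv: "(u, v) \<in> E" "u \<in> set ?xs" "v \<in> set ?xs" for u v
  proof -
    obtain i j where ij: "i < length ?xs" "u = ?xs ! i" "j < length ?xs" "v = ?xs ! j"
      using uv by (metis in_set_conv_nth)
    have zip: "(?xs ! k, ?xs ! Suc k) \<in> set (zip (p # ws) (ws @ [q]))" if "Suc k < length ?xs" for k
      unfolding in_set_zip using that by (intro exI[of _ k]) (auto simp: nth_append nth_Cons')
    have "i \<noteq> j" using uv ij E_loopfree by auto
    then consider "i < j" | "j < i" by linarith
    then show ?thesis
    proof cases
      case 1
      then have "j = Suc i" using chord[of i j] uv ij by simp
      then show ?thesis using zip[of i] ij by blast
    next
      case 2
      then have "i = Suc j" using chord[of j i] uv(1)[THEN E_sym] ij by simp
      then show ?thesis using zip[of j] ij by blast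
    qed
  qed
  ultimately show ?thesis using ws by blast
qed

lemma set_zip_swap: "set (zip ys xs) = (set (zip xs ys))\<inverse>"
  by (induction xs ys rule: list_induct2') auto

text \<open>Chordless walks from \<open>p\<close> to \<open>q\<close> through \<open>C1\<close> and
  through \<open>C2\<close> close up to an induced cycle, as no edge joins \<open>C1\<close> to
  \<open>C2\<close>. The second walk has at least one inner vertex, so two or more on the first
  would give length at least five. The single inner vertex of the first walk is the common
  neighbour.\<close>

lemma common_neighbour_in_component:
  assumes pq: "(p, q) \<notin> E" "p \<notin> C1 \<union> C2" "q \<notin> C1 \<union> C2"
    and disjoint: "C1 \<inter> C2 = {}" "E \<inter> C1 \<times> C2 = {}"
    and C1: "\<And>u v. u \<in> C1 \<Longrightarrow> v \<in> C1 \<Longrightarrow> (u, v) \<in> (E \<inter> C1 \<times> C1)\<^sup>*"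
      "\<exists>u\<in>C1. (u, p) \<in> E" "\<exists>u\<in>C1. (u, q) \<in> E"
    and C2: "\<And>u v. u \<in> C2 \<Longrightarrow> v \<in> C2 \<Longrightarrow> (u, v) \<in> (E \<inter> C2 \<times> C2)\<^sup>*"
      "\<exists>u\<in>C2. (u, p) \<in> E" "\<exists>u\<in>C2. (u, q) \<in> E"
  shows "\<exists>y\<in>C1. (p, y) \<in> E \<and> (q, y) \<in> E"
proof (cases "p = q")
  case True
  obtain u where "u \<in> C1" "(u, p) \<in> E" using C1(2) by blast
  with True E_sym[of u p] show ?thesis by blast
next
  case False
  let ?Z = "\<lambda>ws. set (zip (p # ws) (ws @ [q]))"
  have "\<exists>ws. walk_via C p q ws"
    if "\<And>u v. u \<in> C \<Longrightarrow> v \<in> C \<Longrightarrow> (u, v) \<in> (E \<inter> C \<times> C)\<^sup>*"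
      and ex: "\<exists>u\<in>C. (u, p) \<in> E" "\<exists>u\<in>C. (u, q) \<in> E" for C
  proof -
    obtain u v where "u \<in> C" "(u, p) \<in> E" "v \<in> C" "(v, q) \<in> E" using ex by blast
    with that(1) E_sym[of u p] show ?thesis by (intro walk_via_exists[of p u C v q])
  qed
  from this[OF C1] this[OF C2] obtain vs1 vs2 where vs: "walk_via C1 p q vs1" "walk_via C2 p q vs2"
    by blast
  have notin: "p \<notin> C1" "q \<notin> C1" "p \<notin> C2" "q \<notin> C2" using pq by auto
  obtain ws1 where ws1: "walk_via C1 p q ws1" "distinct (p # ws1 @ [q])"
      "E \<inter> set (p # ws1 @ [q]) \<times> set (p # ws1 @ [q]) \<subseteq> ?Z ws1 \<union> (?Z ws1)\<inverse>"
    using shortest_walk[OF vs(1) False notin(1,2)] by (elim exE conjE)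
  obtain ws2 where ws2: "walk_via C2 p q ws2" "distinct (p # ws2 @ [q])"
      "E \<inter> set (p # ws2 @ [q]) \<times> set (p # ws2 @ [q]) \<subseteq> ?Z ws2 \<union> (?Z ws2)\<inverse>"
    using shortest_walk[OF vs(2) False notin(3,4)] by (elim exE conjE)
  note ws = ws1 ws2
  have sub: "set ws1 \<subseteq> C1" "set ws2 \<subseteq> C2" and zE: "?Z ws1 \<subseteq> E" "?Z ws2 \<subseteq> E"
    using ws unfolding walk_via_def successively_E_conv_zip by auto
  have ne: "ws1 \<noteq> []" "ws2 \<noteq> []" using zE pq by auto
  have "length ws1 = 1"
  proof (rule ccontr)
    assume "length ws1 \<noteq> 1"
    then have len: "length ws1 \<ge> 2" using ne by (cases ws1) (auto simp: Suc_le_eq)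
    \<comment> \<open>The cycle runs from \<open>p\<close> to \<open>q\<close> through
      \<open>C1\<close> and back through \<open>C2\<close>; hence the arcs of the second walk enter
      reversed.\<close>
    let ?vs = "p # ws1 @ q # rev ws2"
    have "zip (q # rev ws2) (rev ws2 @ [p]) = rev (zip (ws2 @ [q]) (p # ws2))"
      using zip_rev[of "ws2 @ [q]" "p # ws2"] by simp
    moreover have "zip ((p # ws1) @ (q # rev ws2)) ((ws1 @ [q]) @ (rev ws2 @ [p])) =
        zip (p # ws1) (ws1 @ [q]) @ zip (q # rev ws2) (rev ws2 @ [p])"
      by (rule zip_append) simp
    moreover have "?vs = (p # ws1) @ (q # rev ws2)" "rotate1 ?vs = (ws1 @ [q]) @ (rev ws2 @ [p])"
      by simp_all
    ultimately have "set (zip ?vs (rotate1 ?vs)) = ?Z ws1 \<union> set (zip (ws2 @ [q]) (p # ws2))"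
      by (simp only: set_append set_rev)
    then have zip: "set (zip ?vs (rotate1 ?vs)) = ?Z ws1 \<union> (?Z ws2)\<inverse>"
      by (simp only: set_zip_swap[of "ws2 @ [q]" "p # ws2"])
    show False
    proof (rule no_long_induced_cycle)
      show "distinct ?vs" using ws(2,5) sub disjoint(1) by auto
      show "length ?vs > 4" using len ne by (cases ws2) auto
      show "set (zip ?vs (rotate1 ?vs)) \<subseteq> E" 
        unfolding zip using zE(1) converse_subset_E[OF zE(2)] by (rule Un_least)
      \<comment> \<open>Without edges between the two interiors, every chord of the cycle would
        already be a chord of one of the walks.\<close>
      have cross: "(u, v) \<notin> E" if "u \<in> set ws1" "v \<in> set ws2" for u v
        using that sub disjoint(2) by blast
      have "E \<inter> set ?vs \<times> set ?vs \<subseteq> E \<inter> set (p # ws1 @ [q]) \<times> set (p # ws1 @ [q]) \<union>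
          E \<inter> set (p # ws2 @ [q]) \<times> set (p # ws2 @ [q])"
      proof (rule subrelI)
        fix u v assume "(u, v) \<in> E \<inter> set ?vs \<times> set ?vs"
        then have "(u, v) \<in> E" "u \<in> set ?vs" "v \<in> set ?vs" by blast+
        moreover from this(1) have "\<not> (u \<in> set ws1 \<and> v \<in> set ws2)" "\<not> (v \<in> set ws1 \<and> u \<in> set ws2)"
          using cross[of u v] cross[of v u] E_sym[of u v] by blast+
        ultimately show "(u, v) \<in> E \<inter> set (p # ws1 @ [q]) \<times> set (p # ws1 @ [q]) \<union>
            E \<inter> set (p # ws2 @ [q]) \<times> set (p # ws2 @ [q])" by (simp, argo)
      qed
      also have "\<dots> \<subseteq> ?Z ws1 \<union> (?Z ws1)\<inverse> \<union> (?Z ws2 \<union> (?Z ws2)\<inverse>)"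
        by (intro Un_mono ws)
      finally show "E \<inter> set ?vs \<times> set ?vs \<subseteq> set (zip ?vs (rotate1 ?vs)) \<union> (set (zip ?vs (rotate1 ?vs)))\<inverse>"
        unfolding zip converse_Un converse_converse by blast
    qed
  qed
  then obtain y where "ws1 = [y]" by (auto simp: length_Suc_conv)
  with sub zE have "y \<in> C1" "(p, y) \<in> E" "(y, q) \<in> E" by auto
  then show ?thesis using E_sym[of y q] by blast
qed

text \<open>By \<open>cds_mono\<close>, adding single vertices is enough to express
  inclusion-maximality. The complements of these sets are the minimal vertex sets that meet every
  connected dominating set.\<close>

definition maximal_non_cds :: "'a set \<Rightarrow> bool" where
  "maximal_non_cds D \<longleftrightarrow> D \<subseteq> V \<and> \<not> connected_dominating_set G D \<and>
     (\<forall>v\<in>V - D. connected_dominating_set G (insert v D))"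

section \<open>Components of maximal sets that are not connected dominating sets\<close>

definition component :: "'a set \<Rightarrow> 'a \<Rightarrow> 'a set" where
  "component D d = {v \<in> D. (d, v) \<in> (E \<inter> D \<times> D)\<^sup>*}"

text \<open>Every vertex on a walk inside \<open>D\<close> from \<open>d\<close> itself belongs to
  the component of \<open>d\<close>.\<close>

lemma component_connected:
  assumes "u \<in> component D d" "v \<in> component D d"
  shows "(u, v) \<in> (E \<inter> component D d \<times> component D d)\<^sup>*"
proof -
  let ?C = "component D d"
  have "(d, v) \<in> (E \<inter> ?C \<times> ?C)\<^sup>*" if "v \<in> ?C" for v
  proof -
    have "(d, v) \<in> (E \<inter> D \<times> D)\<^sup>*" "v \<in> D" using that by (auto simp: component_def)
    then show ?thesis
    proof (induction rule: rtrancl_induct)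
      case (step u v)
      then have "u \<in> D" by auto
      moreover from this step have "u \<in> ?C" "v \<in> ?C"
        unfolding component_def by (auto intro: rtrancl_into_rtrancl)
      ultimately show ?case using step by (auto intro: rtrancl_into_rtrancl)
    qed simp
  qed
  from rtrancl_trans[OF rtrancl_E_sym[OF this[OF assms(1)]] this[OF assms(2)]] show ?thesis .
qed

text \<open>Adding \<open>h\<close> makes the set connected. A walk from \<open>d\<close> to
  \<open>h\<close> stays in the component of \<open>d\<close> until it first reaches
  \<open>h\<close>, so this component contains a neighbour of \<open>h\<close>.\<close>

lemma component_full:
  assumes "maximal_non_cds D" "d \<in> D" "h \<in> V - D"
  shows "\<exists>u\<in>component D d. (u, h) \<in> E"
proof -
  have "(d, h) \<in> (E \<inter> insert h D \<times> insert h D)\<^sup>*"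
    using assms unfolding maximal_non_cds_def cds_iff by blast
  moreover have "v \<in> component D d \<or> (\<exists>u\<in>component D d. (u, h) \<in> E)"
    if "(d, v) \<in> (E \<inter> insert h D \<times> insert h D)\<^sup>*" for v
    using that
  proof (induction rule: rtrancl_induct)
    case base
    then show ?case using assms by (simp add: component_def)
  next
    case (step u v)
    show ?case
    proof (cases "\<exists>u\<in>component D d. (u, h) \<in> E")
      case False
      with step have "u \<in> component D d" by blast
      moreover from this False step(2) have "v \<in> D" by blast
      ultimately have "v \<in> component D d"
        using step(2) by (auto simp: component_def intro: rtrancl_into_rtrancl)
      then show ?thesis by blast
    qed blast
  qed
  ultimately have "h \<in> component D d \<or> (\<exists>u\<in>component D d. (u, h) \<in> E)" by blast
  moreover have "h \<notin> component D d" using assms by (simp add: component_def)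
  ultimately show ?thesis by blast
qed

text \<open>If \<open>x\<close> were in \<open>D\<close>, then \<open>D\<close> would be
  disconnected, and \<open>p\<close> and \<open>q\<close> would have a common neighbour in each of
  two components. But \<open>x\<close> is adjacent to both of these neighbours and joins the
  components.\<close>

lemma separator_closed:
  assumes S: "S \<in> {A, B}" and D: "maximal_non_cds D"
    and pq: "p \<in> S - D" "q \<in> S - D"
    and x: "\<And>y. (p, y) \<in> E \<Longrightarrow> (q, y) \<in> E \<Longrightarrow> (x, y) \<in> E"
  shows "x \<notin> D"
proof
  assume "x \<in> D"
  have V: "p \<in> V - D" "q \<in> V - D" "D \<subseteq> V" using pq S sides D by (auto simp: maximal_non_cds_def)
  \<comment> \<open>The component of \<open>x\<close> already dominates everything outside
    \<open>D\<close>, so \<open>D\<close> can only fail by being disconnected.\<close>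
  have "\<forall>v\<in>V - D. \<exists>u\<in>D. (u, v) \<in> E"
    using component_full[OF D \<open>x \<in> D\<close>] by (auto simp: component_def)
  with D \<open>x \<in> D\<close> obtain d1 d2 where d: "d1 \<in> D" "d2 \<in> D" "(d1, d2) \<notin> (E \<inter> D \<times> D)\<^sup>*"
    unfolding maximal_non_cds_def cds_iff by blast
  let ?C = "component D"
  have sep: "(u, v) \<notin> (E \<inter> D \<times> D)\<^sup>*" if "u \<in> ?C d1" "v \<in> ?C d2" for u v
    using that d rtrancl_E_sym unfolding component_def by (blast intro: rtrancl_trans)
  have disj: "?C d1 \<inter> ?C d2 = {}" using sep by blast
  have noE: "E \<inter> ?C d1 \<times> ?C d2 = {}" using sep by (auto simp: component_def)
  then have noE': "E \<inter> ?C d2 \<times> ?C d1 = {}" using E_sym by blast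
  have pq': "(p, q) \<notin> E" using side_independent S pq by blast
  have notin: "p \<notin> ?C d1 \<union> ?C d2" "q \<notin> ?C d1 \<union> ?C d2" using pq by (auto simp: component_def)
  note full = component_full[OF D d(1) V(1)] component_full[OF D d(1) V(2)]
    component_full[OF D d(2) V(1)] component_full[OF D d(2) V(2)]
  obtain y1 where y1: "y1 \<in> ?C d1" "(p, y1) \<in> E" "(q, y1) \<in> E"
    using common_neighbour_in_component[OF pq' notin disj noE component_connected full(1,2)
        component_connected full(3,4)] by blast
  obtain y2 where y2: "y2 \<in> ?C d2" "(p, y2) \<in> E" "(q, y2) \<in> E"
    using common_neighbour_in_component[OF pq', of "?C d2" "?C d1"] notin disj noE' component_connected full
    by (metis Un_commute inf_commute)
  have "(y1, x) \<in> E \<inter> D \<times> D" "(x, y2) \<in> E \<inter> D \<times> D"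
    using x[of y1] x[of y2] y1 y2 \<open>x \<in> D\<close> E_sym by (auto simp: component_def)
  then have "(y1, y2) \<in> (E \<inter> D \<times> D)\<^sup>*" by (meson r_into_rtrancl rtrancl_trans)
  then show False using sep y1(1) y2(1) by blast
qed

text \<open>Two vertices with the same common neighbours as all of \<open>X\<close> suffice, since
  \<open>separator_closed\<close> then applies to every element of \<open>X\<close>.\<close>

lemma separator_certificate_side:
  assumes S: "S \<in> {A, B}" and X: "X \<subseteq> S"
  shows "\<exists>ys. set ys \<subseteq> X \<and> length ys \<le> 2 \<and>
    (\<forall>D. maximal_non_cds D \<longrightarrow> set ys \<inter> D = {} \<longrightarrow> X \<inter> D = {})"
proof (cases "X = {}")
  case True
  then show ?thesis by (intro exI[of _ "[]"]) simp
next
  case False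
  from common_neighbours_of_pair[OF S X this] obtain p q where pq: "p \<in> X" "q \<in> X"
    "\<forall>y. (p, y) \<in> E \<longrightarrow> (q, y) \<in> E \<longrightarrow> (\<forall>x\<in>X. (x, y) \<in> E)" by blast
  have "X \<inter> D = {}" if D: "maximal_non_cds D" "set [p, q] \<inter> D = {}" for D
  proof -
    have "p \<in> S - D" "q \<in> S - D" using pq(1,2) X D(2) by auto
    from separator_closed[OF S D(1) this] pq(3) have "x \<notin> D" if "x \<in> X" for x using that by blast
    then show ?thesis by blast
  qed
  with pq show ?thesis by (intro exI[of _ "[p, q]"]) auto
qed

text \<open>Two vertices are taken from each side. The bound 4 on the length is the number of rounds
  of \<open>branch\<close> in the search.\<close>

lemma separator_certificate:
  assumes "X \<subseteq> V"
  shows "\<exists>ys. set ys \<subseteq> X \<and> length ys \<le> 4 \<and>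
    (\<forall>D. maximal_non_cds D \<longrightarrow> set ys \<inter> D = {} \<longrightarrow> X \<inter> D = {})"
proof -
  obtain ys where ys: "set ys \<subseteq> X \<inter> A" "length ys \<le> 2"
    "\<And>D. maximal_non_cds D \<Longrightarrow> set ys \<inter> D = {} \<Longrightarrow> X \<inter> A \<inter> D = {}"
    using separator_certificate_side[of A "X \<inter> A"] by auto
  obtain zs where zs: "set zs \<subseteq> X \<inter> B" "length zs \<le> 2"
    "\<And>D. maximal_non_cds D \<Longrightarrow> set zs \<inter> D = {} \<Longrightarrow> X \<inter> B \<inter> D = {}"
    using separator_certificate_side[of B "X \<inter> B"] by auto
  have "X \<inter> D = {}" if "maximal_non_cds D" "set (ys @ zs) \<inter> D = {}" for D
  proof -
    have "X \<inter> A \<inter> D = {}" "X \<inter> B \<inter> D = {}" using ys(3) zs(3) that by auto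
    moreover have "X \<subseteq> A \<union> B" using assms sides by simp
    ultimately show ?thesis by blast
  qed
  with ys(1,2) zs(1,2) show ?thesis by (intro exI[of _ "ys @ zs"]) auto
qed

end

section \<open>The enumeration algorithm\<close>

text \<open>Looking at a list of at most one entry replaces indexing: it is covered by the
  \<open>ptime\<close> rules and gives \<open>False\<close> out of range.\<close>

definition adj :: "bool list list \<Rightarrow> nat \<Rightarrow> nat \<Rightarrow> bool" where
  "adj M u v \<longleftrightarrow> list_ex (\<lambda>r. list_ex (\<lambda>b. b) (take 1 (drop v r))) (take 1 (drop u M))"

text \<open>One round of breadth-first search that leaves vertices of \<open>D\<close> only, but may
  enter any vertex.\<close>

definition grow :: "bool list list \<Rightarrow> nat list \<Rightarrow> nat list \<Rightarrow> nat list" where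
  "grow M D R = filter (\<lambda>v. v \<in> set R \<or> list_ex (\<lambda>u. u \<in> set D \<and> adj M u v) R) [0..<length M]"

text \<open>The number of matrix entries bounds the number of arcs, so this many rounds reach a
  fixed point.\<close>

definition reach :: "bool list list \<Rightarrow> nat list \<Rightarrow> nat \<Rightarrow> nat list" where
  "reach M D d = (grow M D ^^ length (concat M)) [d]"

text \<open>A search that expands vertices of \<open>D\<close> only tests connectivity and
  domination at once: it covers all vertices exactly if \<open>D\<close> is connected and
  dominating.\<close>

definition is_cds :: "bool list list \<Rightarrow> nat list \<Rightarrow> bool" where
  "is_cds M D \<longleftrightarrow> list_ex (\<lambda>d. set [0..<length M] \<subseteq> set (reach M D d)) D"

definition free :: "nat list list \<Rightarrow> nat list \<Rightarrow> bool" where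
  "free G D \<longleftrightarrow> list_all (\<lambda>g. \<not> set g \<subseteq> set D) G"

definition extend :: "bool list list \<Rightarrow> nat list list \<Rightarrow> nat list \<Rightarrow> nat list" where
  "extend M G F = foldl (\<lambda>D v. if free G (v # D) then v # D else D) F [0..<length M]"

text \<open>The initial filter yields a sorted list without repetitions, which keeps the size of the
  result below \<open>sz [0..<length M]\<close>.\<close>

definition shrink :: "bool list list \<Rightarrow> nat list \<Rightarrow> nat list" where
  "shrink M D = foldl
     (\<lambda>D v. if is_cds M (filter (\<lambda>u. u \<noteq> v) D) then filter (\<lambda>u. u \<noteq> v) D else D)
     (filter (\<lambda>v. v \<in> set D) [0..<length M]) [0..<length M]"

text \<open>The empty list can signal failure because a connected dominating set is never
  empty.\<close>

definition attempt :: "bool list list \<Rightarrow> nat list list \<Rightarrow> nat list \<Rightarrow> nat list" where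
  "attempt M G F =
     (let D = extend M G F in if free G D \<and> is_cds M D then shrink M D else [])"

text \<open>Each round adds one more set \<open>g - {y}\<close> to a candidate. Old candidates are
  kept, so \<open>k\<close> rounds cover unions of at most \<open>k\<close> such sets.\<close>

definition branch :: "nat list list \<Rightarrow> nat list list \<Rightarrow> nat list list" where
  "branch G C =
     C @ concat (map (\<lambda>F. concat (map (\<lambda>g. map (\<lambda>y. F @ filter (\<lambda>u. u \<noteq> y) g) g) G)) C)"

definition find_new :: "bool list list \<Rightarrow> nat list list \<Rightarrow> nat list" where
  "find_new M G = foldl (\<lambda>d F. if d = [] then attempt M G F else d) []
     (branch G (branch G (branch G (branch G [[]]))))"

text \<open>The components are the pending output (at most one characteristic vector), the adjacency
  matrix and the solutions found so far. An empty first component ends the output loop.\<close>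

type_synonym enum_state = "bool list list \<times> bool list list \<times> nat list list"

definition enum_step :: "enum_state \<Rightarrow> enum_state" where
  "enum_step z = (let d = find_new (fst (snd z)) (snd (snd z)) in
     if d = [] then ([], snd z)
     else ([map (\<lambda>v. v \<in> set d) [0..<length (fst (snd z))]], fst (snd z), d # snd (snd z)))"

section \<open>Polynomial running time of the search\<close>

lemma ptime_adj [ptime_intros]:
  assumes "ptime M" "ptime u" "ptime v"
  shows "ptime (\<lambda>x. adj (M x) (u x) (v x))"
  unfolding adj_def by (intro ptime_intros assms ptime_comp[OF assms(3)])

text \<open>Below a bound variable, the arguments are read off a tuple; for this the hypotheses are
  also supplied in composed form by \<open>ptime_comp\<close>.\<close>

lemma ptime_grow [ptime_intros]:
  assumes "ptime M" "ptime D" "ptime R"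
  shows "ptime (\<lambda>x. grow (M x) (D x) (R x))"
  unfolding grow_def by (intro ptime_intros assms assms[THEN ptime_comp])

lemma ptime_reach [ptime_intros]:
  assumes "ptime M" "ptime D" "ptime d"
  shows "ptime (\<lambda>x. reach (M x) (D x) (d x))"
  unfolding reach_def
\<comment> \<open>Every round returns a sublist of \<open>[0..<length M]\<close>, so the accumulator
  cannot grow beyond the size of that list.\<close>
proof (rule ptime_funpow[where r = "\<lambda>x. [0..<length (M x)]"])
  show "sz (grow (M x) (D x) a) \<le> sz a + sz [0..<length (M x)] + 1" for x a
    unfolding grow_def by (rule order_trans[OF sz_filter]) simp
qed (intro ptime_intros assms assms[THEN ptime_comp])+

lemma ptime_is_cds [ptime_intros]:
  assumes "ptime M" "ptime D"
  shows "ptime (\<lambda>x. is_cds (M x) (D x))"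
  unfolding is_cds_def by (intro ptime_intros assms assms[THEN ptime_comp])

lemma ptime_free [ptime_intros]:
  assumes "ptime G" "ptime D"
  shows "ptime (\<lambda>x. free (G x) (D x))"
  unfolding free_def by (intro ptime_intros assms assms[THEN ptime_comp])

lemma ptime_extend [ptime_intros]:
  assumes "ptime M" "ptime G" "ptime F"
  shows "ptime (\<lambda>x. extend (M x) (G x) (F x))"
  unfolding extend_def
  by (rule ptime_foldl[where r = "\<lambda>x e. e"];
      (intro ptime_intros assms assms[THEN ptime_comp])?) auto

lemma ptime_shrink [ptime_intros]:
  assumes "ptime M" "ptime D"
  shows "ptime (\<lambda>x. shrink (M x) (D x))"
  unfolding shrink_def
  by (rule ptime_foldl[where r = "\<lambda>x e. ()"];
      (intro ptime_intros assms assms[THEN ptime_comp])?) (auto intro: le_SucI sz_filter)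

lemma ptime_attempt [ptime_intros]:
  assumes "ptime M" "ptime G" "ptime F"
  shows "ptime (\<lambda>x. attempt (M x) (G x) (F x))"
  unfolding attempt_def by (intro ptime_intros assms assms[THEN ptime_comp])

lemma ptime_branch [ptime_intros]:
  assumes "ptime G" "ptime C"
  shows "ptime (\<lambda>x. branch (G x) (C x))"
  unfolding branch_def by (intro ptime_intros assms assms[THEN ptime_comp])

lemma ptime_find_new [ptime_intros]:
  assumes "ptime M" "ptime G"
  shows "ptime (\<lambda>x. find_new (M x) (G x))"
  unfolding find_new_def
  by (rule ptime_foldl[where r = "\<lambda>x. attempt (M x) (G x)"];
      (intro ptime_intros assms assms[THEN ptime_comp])?) auto

lemma ptime_enum_step: "ptime enum_step"
  unfolding enum_step_def by (intro ptime_intros)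

lemma ptime_enum_init: "ptime (\<lambda>M. enum_step ([], M, []))"
  by (intro ptime_comp[OF ptime_enum_step] ptime_intros)

section \<open>Greedy extension and candidate lists\<close>

lemma free_antimono: "free Gs D \<Longrightarrow> set D' \<subseteq> set D \<Longrightarrow> free Gs D'"
  unfolding free_def list_all_iff by blast

text \<open>The last claim is the maximality of the greedy result: a vertex rejected at its turn
  stays rejected, because the set only grows and \<open>free\<close> is antimonotone.\<close>

lemma foldl_extend:
  fixes Gs :: "nat list list"
  defines "step \<equiv> \<lambda>D v. if free Gs (v # D) then v # D else D"
  shows "set D \<subseteq> set (foldl step D xs)"
    and "set (foldl step D xs) \<subseteq> set D \<union> set xs"
    and "free Gs D \<Longrightarrow> free Gs (foldl step D xs)"
    and "v \<in> set xs \<Longrightarrow> v \<notin> set (foldl step D xs) \<Longrightarrow> \<not> free Gs (v # foldl step D xs)"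
proof (induction xs arbitrary: D)
  case (Cons x xs)
  {
    case 1
    then show ?case using Cons.IH(1)[of "step D x"] by (auto simp: step_def)
  next
    case 2
    then show ?case using Cons.IH(2)[of "step D x"] by (auto simp: step_def split: if_splits)
  next
    case 3
    then show ?case using Cons.IH(3)[of "step D x"] by (auto simp: step_def)
  next
    case 4
    show ?case
    proof (cases "v \<in> set xs")
      case True
      then show ?thesis using 4 Cons.IH(4)[of "step D x"] by simp
    next
      case False
      then have v: "v = x" using 4 by simp
      have sub: "set (step D x) \<subseteq> set (foldl step D (x # xs))" using Cons.IH(1)[of "step D x"] by simp
      then have "\<not> free Gs (x # D)" using 4 v by (auto simp: step_def)
      moreover have "set D \<subseteq> set (step D x)" by (auto simp: step_def)
      then have "set (x # D) \<subseteq> set (x # foldl step D (x # xs))" using sub by auto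
      ultimately show ?thesis using free_antimono v by blast
    qed
  }
qed simp_all

lemma foldl_first_nonempty:
  "foldl (\<lambda>d F. if d = [] then f F else d) d0 xs = [] \<longleftrightarrow> d0 = [] \<and> (\<forall>F\<in>set xs. f F = [])"
  "foldl (\<lambda>d F. if d = [] then f F else d) d0 xs \<in> insert d0 (f ` set xs)"
  by (induction xs arbitrary: d0) (auto split: if_splits)

lemma set_branch:
  "set (branch Gs C) = set C \<union> {F @ filter (\<lambda>u. u \<noteq> y) g |F g y. F \<in> set C \<and> g \<in> set Gs \<and> y \<in> set g}"
  unfolding branch_def by auto

lemma branch_subset:
  assumes "\<And>g. g \<in> set Gs \<Longrightarrow> set g \<subseteq> W" "F \<in> set ((branch Gs ^^ k) [[]])"
  shows "set F \<subseteq> W"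
  using assms(2)
proof (induction k arbitrary: F)
  case (Suc k)
  then show ?case using assms(1) by (fastforce simp: set_branch)
qed simp

text \<open>Each entry of \<open>ys\<close> uses one round, and shorter lists are covered because
  \<open>branch\<close> keeps its old candidates.\<close>

lemma branch_complete:
  assumes "length ys \<le> k" "\<And>y. y \<in> set ys \<Longrightarrow> f y \<in> set Gs \<and> y \<in> set (f y)"
  shows "\<exists>F \<in> set ((branch Gs ^^ k) [[]]). set F = (\<Union>y\<in>set ys. set (f y) - {y})"
  using assms
proof (induction k arbitrary: ys)
  case (Suc k)
  show ?case
  proof (cases ys)
    case Nil
    then show ?thesis using Suc.IH[of "[]"] by (auto simp: set_branch)
  next
    case (Cons y zs)
    then obtain F where F: "F \<in> set ((branch Gs ^^ k) [[]])" "set F = (\<Union>y\<in>set zs. set (f y) - {y})"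
      using Suc.IH[of zs] Suc.prems by auto
    have y: "f y \<in> set Gs" "y \<in> set (f y)" using Cons Suc.prems by auto
    let ?F = "F @ filter (\<lambda>u. u \<noteq> y) (f y)"
    have "?F \<in> set ((branch Gs ^^ Suc k) [[]])" using F(1) y by (auto simp: set_branch)
    moreover have "set ?F = (\<Union>y\<in>set ys. set (f y) - {y})" using F(2) Cons by auto
    ultimately show ?thesis by blast
  qed
qed auto

section \<open>Graphs and vertex sets as encoded lists\<close>

definition matrix_of_graph :: "nat pair_pre_digraph \<Rightarrow> bool list list" where
  "matrix_of_graph G = (let n = card (pverts G) in
     map (\<lambda>u. map (\<lambda>v. (u, v) \<in> parcs G) [0..<n]) [0..<n])"

lemma tree_of_set_eq_encode: "tree_of_set n D = encode (map (\<lambda>v. v \<in> D) [0..<n])"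
  by (simp add: tree_of_set_def encode_list_def encode_bool_def comp_def)

lemma tree_of_graph_eq_encode: "tree_of_graph G = encode (matrix_of_graph G)"
  by (simp add: tree_of_graph_def matrix_of_graph_def Let_def encode_list_def comp_def
      tree_of_set_eq_encode[unfolded encode_list_def])

lemma inj_on_tree_of_set: "inj_on (tree_of_set n) (Pow {0..<n})"
proof (rule inj_onI)
  have list: "tree_of_list ts = tree_of_list us \<longleftrightarrow> ts = us" for ts us
    by (induction ts us rule: list_induct2') (auto simp: tree_of_list_def)
  fix D D' assume D: "D \<in> Pow {0..<n}" "D' \<in> Pow {0..<n}" "tree_of_set n D = tree_of_set n D'"
  then have "\<forall>v\<in>{0..<n}. v \<in> D \<longleftrightarrow> v \<in> D'"
    unfolding tree_of_set_def list by (auto simp: tree_of_bool_def split: if_splits)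
  with D show "D = D'" by blast
qed

lemma sz_upt: "sz [0..<n] \<le> n * n + n"
  by (induction n) (auto simp: algebra_simps)

section \<open>Correctness of the search\<close>

locale numbered_chordal_bipartite_graph = chordal_bipartite_graph G A B
  for G :: "nat pair_pre_digraph" and A B +
  fixes n :: nat and M :: "bool list list"
  defines "n \<equiv> card (pverts G)" and "M \<equiv> matrix_of_graph G"
  assumes numbered: "pverts G = {0..<n}"
begin

lemma length_M [simp]: "length M = n"
  by (simp add: M_def matrix_of_graph_def n_def Let_def)

lemma adj_M: "u \<in> V \<Longrightarrow> v \<in> V \<Longrightarrow> adj M u v \<longleftrightarrow> (u, v) \<in> E"
  using numbered
  by (simp add: adj_def M_def matrix_of_graph_def Let_def take_Suc hd_drop_conv_nth flip: n_def)

lemma length_concat_M: "length (concat M) = n * n"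
proof -
  have "map length M = replicate n n"
    by (simp add: M_def matrix_of_graph_def Let_def comp_def map_replicate_const flip: n_def)
  then show ?thesis by (simp add: length_concat sum_list_replicate)
qed

text \<open>Round \<open>k\<close> covers every vertex at most \<open>k\<close> steps away. In a
  finite relation, reachability needs no more steps than there are pairs, and here there are at most
  \<open>n * n\<close>.\<close>

lemma set_reach:
  assumes "d \<in> V" "set D \<subseteq> V"
  shows "set (reach M D d) = {v. (d, v) \<in> (E \<inter> set D \<times> UNIV)\<^sup>*}"
proof -
  let ?R = "E \<inter> set D \<times> UNIV"
  let ?W = "\<lambda>k. set ((grow M D ^^ k) [d])"
  have V: "?W k \<subseteq> V" for k
    using assms(1) numbered by (induction k) (auto simp: grow_def)
  have W_Suc: "?W (Suc k) = ?W k \<union> {v. \<exists>u\<in>?W k. (u, v) \<in> ?R}" for k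
  proof -
    have "?W (Suc k) = {v \<in> V. v \<in> ?W k \<or> (\<exists>u\<in>?W k. u \<in> set D \<and> adj M u v)}"
      using numbered by (auto simp: grow_def list_ex_iff)
    moreover have "v \<in> V \<and> adj M u v \<longleftrightarrow> (u, v) \<in> E" if "u \<in> ?W k" for u v
      using V[of k] that adj_M[of u v] E_V[of u v] by blast
    ultimately show ?thesis using V[of k] by auto
  qed
  have sound: "?W k \<subseteq> {v. (d, v) \<in> ?R\<^sup>*}" for k
  proof (induction k)
    case (Suc k)
    then show ?case unfolding W_Suc[of k] by (blast intro: rtrancl_into_rtrancl)
  qed simp
  have mono: "?W j \<subseteq> ?W k" if "j \<le> k" for j k
    using that by (induction rule: dec_induct) (use W_Suc in blast)+
  have complete: "(d, v) \<in> ?R ^^ k \<Longrightarrow> v \<in> ?W k" for v k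
  proof (induction k arbitrary: v)
    case (Suc k)
    then obtain u where "(d, u) \<in> ?R ^^ k" "(u, v) \<in> ?R" by auto
    with Suc.IH[of u] show ?case unfolding W_Suc[of k] by blast
  qed simp
  have R: "?R \<subseteq> V \<times> V" using E_V by auto
  then have fin: "finite ?R" using finite_V by (meson finite_SigmaI finite_subset)
  have "card ?R \<le> card (V \<times> V)" using R finite_V by (intro card_mono) auto
  then have card: "card ?R \<le> n * n" using finite_V by (simp add: n_def card_cartesian_product)
  have "v \<in> ?W (n * n)" if "(d, v) \<in> ?R\<^sup>*" for v
  proof -
    have "(d, v) \<in> (\<Union>k\<in>{k. k \<le> card ?R}. ?R ^^ k)"
      using that rtrancl_finite_eq_relpow[OF fin] by (simp only:)
    then obtain k where k: "k \<le> card ?R" "(d, v) \<in> ?R ^^ k" by (elim UN_E CollectE)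
    have "v \<in> ?W k" by (rule complete[OF k(2)])
    with mono[OF order_trans[OF k(1) card]] show ?thesis by (rule subsetD)
  qed
  then show ?thesis using sound unfolding reach_def length_concat_M by blast
qed

text \<open>A walk whose arcs all start in \<open>D\<close> can leave \<open>D\<close> only at its
  last vertex. A vertex of \<open>D\<close> is thus reached inside \<open>D\<close>, and any other
  reached vertex has a neighbour in \<open>D\<close>.\<close>

lemma is_cds_iff:
  assumes D: "set D \<subseteq> V"
  shows "is_cds M D \<longleftrightarrow> connected_dominating_set G (set D)"
proof -
  let ?R = "E \<inter> set D \<times> UNIV"
  let ?S = "E \<inter> set D \<times> set D"
  have iff: "is_cds M D \<longleftrightarrow> (\<exists>d\<in>set D. \<forall>v\<in>V. (d, v) \<in> ?R\<^sup>*)"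
    unfolding is_cds_def list_ex_iff length_M set_upt numbered[symmetric]
    using set_reach[OF _ D] D by (intro bex_cong refl) auto
  show ?thesis unfolding iff cds_iff
  proof (intro iffI conjI)
    assume "\<exists>d\<in>set D. \<forall>v\<in>V. (d, v) \<in> ?R\<^sup>*"
    then obtain d where d: "d \<in> set D" "\<And>v. v \<in> V \<Longrightarrow> (d, v) \<in> ?R\<^sup>*" by blast
    show "set D \<subseteq> V" "set D \<noteq> {}" using d(1) assms by auto
    have *: "(v \<in> set D \<longrightarrow> (d, v) \<in> ?S\<^sup>*) \<and> (v \<notin> set D \<longrightarrow> (\<exists>u\<in>set D. (u, v) \<in> E))"
      if "(d, v) \<in> ?R\<^sup>*" for v
      using that
    proof (induction rule: rtrancl_induct)
      case (step u v)
      then show ?case by (auto intro: rtrancl_into_rtrancl)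
    qed (use d in simp)
    show "\<forall>v\<in>V - set D. \<exists>u\<in>set D. (u, v) \<in> E" using * d(2) by blast
    show "\<forall>u\<in>set D. \<forall>v\<in>set D. (u, v) \<in> ?S\<^sup>*"
    proof (intro ballI)
      fix u v assume uv: "u \<in> set D" "v \<in> set D"
      then have "(d, u) \<in> ?S\<^sup>*" "(d, v) \<in> ?S\<^sup>*" using * d(2) D by blast+
      from rtrancl_trans[OF rtrancl_E_sym[OF this(1)] this(2)] show "(u, v) \<in> ?S\<^sup>*" .
    qed
  next
    assume cds: "set D \<subseteq> V \<and> (\<forall>v\<in>V - set D. \<exists>u\<in>set D. (u, v) \<in> E) \<and> set D \<noteq> {} \<and>
      (\<forall>u\<in>set D. \<forall>v\<in>set D. (u, v) \<in> ?S\<^sup>*)"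
    then obtain d where d: "d \<in> set D" by (cases D) auto
    have SR: "?S\<^sup>* \<subseteq> ?R\<^sup>*" by (rule rtrancl_mono) blast
    have in_D: "(d, v) \<in> ?R\<^sup>*" if "v \<in> set D" for v using cds d that SR by blast
    have "(d, v) \<in> ?R\<^sup>*" if v: "v \<in> V" for v
    proof (cases "v \<in> set D")
      case False
      then obtain u where u: "u \<in> set D" "(u, v) \<in> E" using cds v by blast
      then have "(u, v) \<in> ?R" by simp
      with in_D[OF u(1)] show ?thesis by (rule rtrancl_into_rtrancl)
    qed (rule in_D)
    with d show "\<exists>d\<in>set D. \<forall>v\<in>V. (d, v) \<in> ?R\<^sup>*" by blast
  qed
qed

lemma extend_props:
  assumes "set F \<subseteq> V"
  shows "set F \<subseteq> set (extend M Gs F)" "set (extend M Gs F) \<subseteq> V"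
    "free Gs F \<Longrightarrow> free Gs (extend M Gs F)"
    "v \<in> V \<Longrightarrow> v \<notin> set (extend M Gs F) \<Longrightarrow> \<not> free Gs (v # extend M Gs F)"
  using foldl_extend[where D = F and Gs = Gs and xs = "[0..<length M]"] assms numbered
  unfolding extend_def by auto

abbreviation "minimal_cds \<equiv> minimal_connected_dominating_set G"

lemma minimal_cds_subset_V: "minimal_cds D \<Longrightarrow> D \<subseteq> V"
  by (simp add: minimal_connected_dominating_set_def cds_iff)

text \<open>One pass is enough: by \<open>cds_mono\<close>, a vertex that was indispensable when
  tested remains so in the smaller final set. The same monotonicity reduces minimality to deletions
  of single vertices.\<close>

lemma shrink_props:
  assumes D: "set D \<subseteq> V" "is_cds M D"
  shows "minimal_cds (set (shrink M D))" "set (shrink M D) \<subseteq> set D" "sz (shrink M D) \<le> sz [0..<n]"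
proof -
  define step where "step = (\<lambda>D v. if is_cds M (filter (\<lambda>u. u \<noteq> v) D) then filter (\<lambda>u. u \<noteq> v) D else D)"
  have *: "is_cds M (foldl step D xs) \<and> set (foldl step D xs) \<subseteq> set D \<and> sz (foldl step D xs) \<le> sz D \<and>
      (\<forall>v\<in>set xs \<inter> set (foldl step D xs). \<not> connected_dominating_set G (set (foldl step D xs) - {v}))"
    if "is_cds M D" "set D \<subseteq> V" for D xs
    using that
  proof (induction xs arbitrary: D)
    case (Cons x xs)
    let ?D = "step D x" and ?r = "foldl step D (x # xs)"
    have step: "is_cds M ?D" "set ?D \<subseteq> set D" "sz ?D \<le> sz D"
      using Cons.prems by (auto simp: step_def intro: sz_filter)
    then have IH: "is_cds M ?r" "set ?r \<subseteq> set ?D" "sz ?r \<le> sz ?D"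
      "\<forall>v\<in>set xs \<inter> set ?r. \<not> connected_dominating_set G (set ?r - {v})"
      using Cons.IH[of ?D] Cons.prems by auto
    have "\<not> connected_dominating_set G (set ?r - {x})" if "x \<in> set ?r"
    proof
      assume cds: "connected_dominating_set G (set ?r - {x})"
      have "x \<in> set ?D" using that IH by auto
      then have "\<not> is_cds M (filter (\<lambda>u. u \<noteq> x) D)" by (auto simp: step_def split: if_splits)
      moreover have "connected_dominating_set G (set (filter (\<lambda>u. u \<noteq> x) D))"
        by (rule cds_mono[OF cds]) (use IH step Cons.prems in auto)
      ultimately show False using is_cds_iff[of "filter (\<lambda>u. u \<noteq> x) D"] Cons.prems by auto
    qed
    with IH step show ?case by auto
  qed simp
  let ?D0 = "filter (\<lambda>v. v \<in> set D) [0..<length M]"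
  have D0: "set ?D0 = set D" using D numbered by auto
  then have "is_cds M ?D0" using D is_cds_iff[of ?D0] is_cds_iff[of D] by simp
  from *[OF this, of "[0..<length M]"] D D0 have r: "is_cds M (shrink M D)"
    "set (shrink M D) \<subseteq> set D" "sz (shrink M D) \<le> sz ?D0"
    "\<And>v. v \<in> V \<Longrightarrow> v \<in> set (shrink M D) \<Longrightarrow> \<not> connected_dominating_set G (set (shrink M D) - {v})"
    unfolding shrink_def step_def[symmetric] numbered by auto
  show "set (shrink M D) \<subseteq> set D" by fact
  show "sz (shrink M D) \<le> sz [0..<n]" using r(3) sz_filter[of _ "[0..<n]"] by (simp add: order_trans)
  let ?S = "set (shrink M D)"
  have S: "connected_dominating_set G ?S" using r(1,2) D is_cds_iff by blast
  have "\<not> connected_dominating_set G D'" if "D' \<subset> ?S" for D'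
  proof
    assume D': "connected_dominating_set G D'"
    obtain v where v: "v \<in> ?S" "v \<notin> D'" using \<open>D' \<subset> ?S\<close> by blast
    have "connected_dominating_set G (?S - {v})"
      by (rule cds_mono[OF D']) (use v that r(2) D in auto)
    with r(4)[of v] v r(2) D show False by blast
  qed
  with S show "minimal_cds ?S" by (simp add: minimal_connected_dominating_set_def)
qed

text \<open>The result is new because it lies inside a set that contains no member of
  \<open>Gs\<close>.\<close>

lemma attempt_sound:
  assumes F: "set F \<subseteq> V" and r: "attempt M Gs F \<noteq> []"
  shows "minimal_cds (set (attempt M Gs F))" "set (attempt M Gs F) \<notin> set ` set Gs"
    "sz (attempt M Gs F) \<le> sz [0..<n]"
proof -
  let ?D = "extend M Gs F"
  have D: "free Gs ?D" "is_cds M ?D" "attempt M Gs F = shrink M ?D"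
    using r by (auto simp: attempt_def Let_def split: if_splits)
  note V = extend_props(2)[OF F, of Gs]
  show "minimal_cds (set (attempt M Gs F))" "sz (attempt M Gs F) \<le> sz [0..<n]"
    using shrink_props[OF V D(2)] D(3) by auto
  show "set (attempt M Gs F) \<notin> set ` set Gs"
    using D(1) shrink_props(2)[OF V D(2)] D(3) by (auto simp: free_def list_all_iff)
qed

lemma attempt_complete:
  assumes F: "set F \<subseteq> V" and "free Gs F" "connected_dominating_set G (set (extend M Gs F))"
  shows "attempt M Gs F \<noteq> []"
proof -
  let ?D = "extend M Gs F"
  note V = extend_props(2)[OF F, of Gs]
  have D: "free Gs ?D" "is_cds M ?D" using extend_props(3)[OF F] assms V is_cds_iff by auto
  then have "attempt M Gs F = shrink M ?D" by (simp add: attempt_def)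
  moreover have "minimal_cds (set (shrink M ?D))" by (rule shrink_props(1)[OF V D(2)])
  ultimately show ?thesis by (auto simp: minimal_connected_dominating_set_def cds_iff)
qed

lemma find_new_cases:
  "find_new M Gs = [] \<longleftrightarrow> (\<forall>F\<in>set ((branch Gs ^^ 4) [[]]). attempt M Gs F = [])"
  "find_new M Gs \<noteq> [] \<Longrightarrow> \<exists>F\<in>set ((branch Gs ^^ 4) [[]]). find_new M Gs = attempt M Gs F"
proof -
  have "find_new M Gs = foldl (\<lambda>d F. if d = [] then attempt M Gs F else d) [] ((branch Gs ^^ 4) [[]])"
    by (simp add: find_new_def numeral_eq_Suc)
  then show "find_new M Gs = [] \<longleftrightarrow> (\<forall>F\<in>set ((branch Gs ^^ 4) [[]]). attempt M Gs F = [])"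
    "find_new M Gs \<noteq> [] \<Longrightarrow> \<exists>F\<in>set ((branch Gs ^^ 4) [[]]). find_new M Gs = attempt M Gs F"
    using foldl_first_nonempty[of "attempt M Gs" "[]" "(branch Gs ^^ 4) [[]]"] by auto
qed

lemma find_new_sound:
  assumes Gs: "\<And>g. g \<in> set Gs \<Longrightarrow> minimal_cds (set g)" and "find_new M Gs \<noteq> []"
  shows "minimal_cds (set (find_new M Gs))" "set (find_new M Gs) \<notin> set ` set Gs"
    "sz (find_new M Gs) \<le> sz [0..<n]"
proof -
  obtain F where F: "F \<in> set ((branch Gs ^^ 4) [[]])" "find_new M Gs = attempt M Gs F"
    using find_new_cases(2)[OF assms(2)] by blast
  have "set F \<subseteq> V" using branch_subset[OF _ F(1)] Gs minimal_cds_subset_V by blast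
  from attempt_sound[OF this] F(2) assms(2)
  show "minimal_cds (set (find_new M Gs))" "set (find_new M Gs) \<notin> set ` set Gs"
    "sz (find_new M Gs) \<le> sz [0..<n]" by auto
qed

lemma find_new_complete:
  assumes Gs: "\<And>g. g \<in> set Gs \<Longrightarrow> minimal_cds (set g)"
    and D0: "minimal_cds D0" "D0 \<notin> set ` set Gs"
  shows "find_new M Gs \<noteq> []"
proof
  assume Nil: "find_new M Gs = []"
  have Gs_V: "set g \<subseteq> V" "connected_dominating_set G (set g)" if "g \<in> set Gs" for g
    using Gs[OF that] minimal_cds_subset_V by (auto simp: minimal_connected_dominating_set_def)
  have "D0 \<subseteq> V" using D0(1) by (rule minimal_cds_subset_V)
  then obtain L0 where L0: "set L0 = D0" using finite_V finite_list finite_subset by metis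
  have "free Gs L0"
    unfolding free_def list_all_iff
  proof (intro ballI notI)
    fix g assume g: "g \<in> set Gs" "set g \<subseteq> set L0"
    then have "set g \<noteq> D0" using D0(2) by blast
    with g L0 have "set g \<subset> D0" by blast
    with D0(1) Gs_V(2)[OF g(1)] show False by (simp add: minimal_connected_dominating_set_def)
  qed
  define D where "D = extend M Gs L0"
  have L0V: "set L0 \<subseteq> V" using L0 \<open>D0 \<subseteq> V\<close> by simp
  note D = extend_props[where Gs = Gs, OF L0V, folded D_def]
  have D_free: "free Gs D" using D(3) \<open>free Gs L0\<close> by blast
  \<comment> \<open>\<open>D\<close> contains the missing solution \<open>D0\<close>; this is what
    the final equality of \<open>D'\<close> and \<open>D\<close> contradicts.\<close>
  have D_cds: "connected_dominating_set G (set D)"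
    using cds_mono[of D0 "set D"] D0(1) D(1,2) L0 by (simp add: minimal_connected_dominating_set_def)
  define X where "X = V - set D"
  obtain ys where ys: "set ys \<subseteq> X" "length ys \<le> 4"
    "\<And>D'. maximal_non_cds D' \<Longrightarrow> set ys \<inter> D' = {} \<Longrightarrow> X \<inter> D' = {}"
    using separator_certificate[of X] by (auto simp: X_def)
  \<comment> \<open>By maximality of \<open>D\<close>, adding \<open>y\<close> completes a known
    solution, which must use \<open>y\<close> as \<open>D\<close> contains none.\<close>
  have "\<exists>g. g \<in> set Gs \<and> y \<in> set g \<and> set g - {y} \<subseteq> set D" if "y \<in> X" for y
  proof -
    have "\<not> free Gs (y # D)" using D(4)[of y] that by (simp add: X_def)
    then obtain g where "g \<in> set Gs" "set g \<subseteq> insert y (set D)" by (auto simp: free_def list_all_iff)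
    moreover have "\<not> set g \<subseteq> set D" using D_free \<open>g \<in> set Gs\<close> by (auto simp: free_def list_all_iff)
    ultimately show ?thesis by blast
  qed
  then obtain f where f: "\<And>y. y \<in> X \<Longrightarrow> f y \<in> set Gs \<and> y \<in> set (f y) \<and> set (f y) - {y} \<subseteq> set D"
    by metis
  obtain F where F: "F \<in> set ((branch Gs ^^ 4) [[]])" "set F = (\<Union>y\<in>set ys. set (f y) - {y})"
    using branch_complete[OF ys(2), of f Gs] f ys(1) by blast
  have F_D: "set F \<subseteq> set D" using F(2) f ys(1) by blast
  then have F_V: "set F \<subseteq> V" using D(2) by blast
  have F_free: "free Gs F" by (rule free_antimono[OF D_free F_D])
  define D' where "D' = extend M Gs F"
  note D' = extend_props[where Gs = Gs, OF F_V, folded D'_def]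
  have D'_free: "free Gs D'" using D'(3) F_free by blast
  have "attempt M Gs F = []" using Nil F(1) find_new_cases(1) by blast
  then have not_cds: "\<not> connected_dominating_set G (set D')"
    using attempt_complete[OF F_V F_free] D'_def by blast
  \<comment> \<open>Any added vertex completes a known solution, and supersets of solutions are
    connected dominating sets.\<close>
  have "maximal_non_cds (set D')"
    unfolding maximal_non_cds_def
  proof (intro conjI ballI)
    fix v assume v: "v \<in> V - set D'"
    then have "\<not> free Gs (v # D')" using D'(4) by blast
    then obtain g where g: "g \<in> set Gs" "set g \<subseteq> insert v (set D')" by (auto simp: free_def list_all_iff)
    show "connected_dominating_set G (insert v (set D'))"
      by (rule cds_mono[OF Gs_V(2)[OF g(1)] g(2)]) (use v D'(2) in auto)
  qed (use D'(2) not_cds in auto)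
  \<comment> \<open>An entry \<open>y\<close> in \<open>D'\<close> would complete the solution
    \<open>f y\<close>, whose other vertices lie in \<open>F\<close>.\<close>
  moreover have "set ys \<inter> set D' = {}"
  proof (rule ccontr)
    assume "set ys \<inter> set D' \<noteq> {}"
    then obtain y where y: "y \<in> set ys" "y \<in> set D'" by blast
    then have "set (f y) \<subseteq> set D'" using F(2) D'(1) by blast
    moreover have "f y \<in> set Gs" using f y ys(1) by blast
    ultimately show False using D'_free by (auto simp: free_def list_all_iff)
  qed
  ultimately have "X \<inter> set D' = {}" by (rule ys(3))
  then have "set D' \<subseteq> set D" using D'(2) by (auto simp: X_def)
  \<comment> \<open>Adding \<open>v\<close> to \<open>D'\<close> would stay inside \<open>D\<close>,
    which contains no known solution, against the maximality of \<open>D'\<close>.\<close>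
  moreover have "v \<in> set D'" if "v \<in> set D" for v
  proof (rule ccontr)
    assume "v \<notin> set D'"
    moreover have "v \<in> V" using that D(2) by blast
    ultimately have "\<not> free Gs (v # D')" using D'(4) by blast
    moreover have "set (v # D') \<subseteq> set D" using that \<open>set D' \<subseteq> set D\<close> by simp
    ultimately show False using free_antimono[OF D_free] by blast
  qed
  ultimately have "set D' = set D" by blast
  with D_cds not_cds show False by simp
qed

section \<open>The run of the algorithm on a fixed graph\<close>

primrec found :: "nat \<Rightarrow> nat list list" where
  "found 0 = []"
| "found (Suc k) = find_new M (found k) # found k"

abbreviation "num_solutions \<equiv> card {D. minimal_cds D}"

lemma finite_solutions: "finite {D. minimal_cds D}"
  by (rule finite_subset[of _ "Pow V"]) (use minimal_cds_subset_V finite_V in auto)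

lemma length_found [simp]: "length (found k) = k"
  by (induction k) auto

lemma found_props:
  assumes "k \<le> num_solutions"
  shows "distinct (map set (found k)) \<and>
    (\<forall>g\<in>set (found k). minimal_cds (set g) \<and> g \<noteq> [] \<and> sz g \<le> sz [0..<n])"
  using assms
proof (induction k)
  case (Suc k)
  then have IH: "distinct (map set (found k))" "\<And>g. g \<in> set (found k) \<Longrightarrow> minimal_cds (set g)"
    "\<forall>g\<in>set (found k). minimal_cds (set g) \<and> g \<noteq> [] \<and> sz g \<le> sz [0..<n]" by auto
  \<comment> \<open>Only \<open>k\<close> solutions have been found, fewer than there are, so some
    solution \<open>D0\<close> is missing and the search succeeds.\<close>
  have "card (set (map set (found k))) = k" using distinct_card[OF IH(1)] by simp
  then have "set (map set (found k)) \<noteq> {D. minimal_cds D}" using Suc.prems by auto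
  moreover have "set (map set (found k)) \<subseteq> {D. minimal_cds D}" using IH(2) by auto
  ultimately obtain D0 where "minimal_cds D0" "D0 \<notin> set ` set (found k)" by auto
  from find_new_complete[OF IH(2) this] have "find_new M (found k) \<noteq> []" by blast
  with find_new_sound[OF IH(2) this] IH show ?case by simp
qed simp

lemma set_found: "set ` set (found num_solutions) = {D. minimal_cds D}"
proof (rule card_subset_eq[OF finite_solutions])
  note found_props[OF le_refl]
  then show "set ` set (found num_solutions) \<subseteq> {D. minimal_cds D}"
    "card (set ` set (found num_solutions)) = num_solutions"
    using distinct_card[of "map set (found num_solutions)"] by auto
qed

lemma find_new_found:
  shows "k < num_solutions \<Longrightarrow> find_new M (found k) \<noteq> []"
    and "find_new M (found num_solutions) = []"
proof -
  show "find_new M (found k) \<noteq> []" if "k < num_solutions"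
    using found_props[of "Suc k"] that by simp
  show "find_new M (found num_solutions) = []"
    using find_new_sound(1,2)[of "found num_solutions"] found_props[OF le_refl] set_found by blast
qed

lemma enum_step_found:
  assumes "k \<le> num_solutions"
  shows "enum_step (r, M, found k) =
    (if k < num_solutions
     then ([map (\<lambda>v. v \<in> set (find_new M (found k))) [0..<n]], M, found (Suc k))
     else ([], M, found k))"
proof (cases "k < num_solutions")
  case True
  then show ?thesis using find_new_found(1) by (simp add: enum_step_def Let_def)
next
  case False
  then have "k = num_solutions" using assms by simp
  then have "find_new M (found k) = []" using find_new_found(2) by (simp only:)
  then show ?thesis using False by (simp add: enum_step_def Let_def)
qed

text \<open>The initial state already results from one step. After \<open>k\<close> further steps,
  the solution with index \<open>k\<close>, counted from 0, is therefore both pending and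
  recorded.\<close>

lemma enum_steps:
  "k \<le> num_solutions \<Longrightarrow> (enum_step ^^ k) (enum_step ([], M, [])) =
    (if k < num_solutions
     then ([map (\<lambda>v. v \<in> set (find_new M (found k))) [0..<n]], M, found (Suc k))
     else ([], M, found k))"
proof (induction k)
  case 0
  then show ?case using enum_step_found[of 0 "[]"] by simp
next
  case (Suc k)
  then have "(enum_step ^^ Suc k) (enum_step ([], M, [])) =
      enum_step ([map (\<lambda>v. v \<in> set (find_new M (found k))) [0..<n]], M, found (Suc k))"
    by simp
  also have "\<dots> = (if Suc k < num_solutions
     then ([map (\<lambda>v. v \<in> set (find_new M (found (Suc k)))) [0..<n]], M, found (Suc (Suc k)))
     else ([], M, found (Suc k)))"
    by (rule enum_step_found[OF Suc.prems])
  finally show ?case .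
qed

text \<open>New solutions are put in front, so the order of output is the reverse of
  \<open>found\<close>.\<close>

lemma map_found: "map (\<lambda>k. h (find_new M (found k))) [0..<k] = rev (map h (found k))"
  by (induction k) auto

text \<open>Every recorded solution is at most as large as \<open>[0..<n]\<close>, and
  \<open>n\<close> is at most \<open>sz M\<close>. Hence a state reached after \<open>k\<close>
  steps, with at most \<open>k + 1\<close> recorded solutions, has polynomial size in
  \<open>sz M + k\<close>.\<close>

lemma sz_enum_steps:
  assumes "k \<le> num_solutions"
  shows "sz ((enum_step ^^ k) (enum_step ([], M, []))) \<le>
    (3 * (sz M + k) + 4) + (sz M + k + 1) * ((sz M + k) * (sz M + k) + (sz M + k) + 1)"
proof -
  let ?m = "sz M + k"
  have n: "n \<le> ?m" using length_le_sz[of M] by simp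
  have bits: "sz (map P [0..<n]) \<le> 2 * n" for P :: "nat \<Rightarrow> bool"
  proof -
    have "sz (map P xs) \<le> 2 * length xs" for xs
      by (induction xs) (use sz_bool in \<open>auto simp: add_mono intro: order_trans[OF add_mono]\<close>)
    from this[of "[0..<n]"] show ?thesis by simp
  qed
  have upt: "sz [0..<n] \<le> ?m * ?m + ?m"
    using sz_upt[of n] mult_mono[OF n n] n by simp
  have found: "sz (found j) \<le> j * (?m * ?m + ?m + 1)" if "j \<le> num_solutions" for j
    using found_props[OF that]
  proof (induction j)
    case (Suc j)
    then have "sz (find_new M (found j)) \<le> ?m * ?m + ?m" using upt by simp
    with Suc show ?case by simp
  qed simp
  have le: "j * (?m * ?m + ?m + 1) \<le> (?m + 1) * (?m * ?m + ?m + 1)" if "j \<le> Suc k" for j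
    using that by (intro mult_mono) auto
  show ?thesis
  proof (cases "k < num_solutions")
    case True
    then have "sz (found (Suc k)) \<le> (?m + 1) * (?m * ?m + ?m + 1)"
      using order_trans[OF found le, of "Suc k"] by simp
    then show ?thesis
      using True assms bits[of "\<lambda>v. v \<in> set (find_new M (found k))"] n
      by (simp add: enum_steps del: found.simps)
  next
    case False
    then show ?thesis
      using assms order_trans[OF found le, of k] by (simp add: enum_steps del: found.simps)
  qed
qed

end

theorem theorem21:
  shows "\<exists>c. enumerates_in_incremental_poly_time c
           {G :: nat pair_pre_digraph. chordal_bipartite G \<and> pverts G = {0..<card (pverts G)}}
           tree_of_graph
           (\<lambda>G. tree_of_set (card (pverts G)) ` {D. minimal_connected_dominating_set G D})"
proof -
  define Q where "Q = (\<lambda>m :: nat. (3 * m + 4) + (m + 1) * (m * m + m + 1))"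
  have Q: "polynomial Q" unfolding Q_def by (intro polynomial_intros)
  \<comment> \<open>The program and its time bound are fixed here, before any graph is
    considered.\<close>
  obtain c p where "polynomial p" and c: "\<And>x N.
    (\<forall>k<N. fst ((enum_step ^^ k) (enum_step ([], x, []))) \<noteq> []) \<and>
    fst ((enum_step ^^ N) (enum_step ([], x, []))) = [] \<and>
    (\<forall>k\<le>N. sz ((enum_step ^^ k) (enum_step ([], x, []))) \<le> Q (sz x + k)) \<Longrightarrow>
    (\<exists>t out s'. exec c (initial_state (encode x)) t out s' \<and>
      map snd out = map (\<lambda>k. encode (hd (fst ((enum_step ^^ k) (enum_step ([], x, [])))))) [0..<N] \<and>
      (\<forall>i<N. fst (out ! i) \<le> p (sz x + Suc i)) \<and> t \<le> p (sz x + N))"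
    using exec_enumeration[OF ptime_enum_init ptime_enum_step Q] by blast
  then obtain P where P: "p = poly P" by (auto simp: polynomial_def)
  show ?thesis
    unfolding enumerates_in_incremental_poly_time_def
  proof (intro exI[of _ c] exI[of _ P] ballI)
    fix G :: "nat pair_pre_digraph"
    assume "G \<in> {G. chordal_bipartite G \<and> pverts G = {0..<card (pverts G)}}"
    then obtain A B where "numbered_chordal_bipartite_graph G A B"
      unfolding chordal_bipartite_def bipartite_def numbered_chordal_bipartite_graph_def
        numbered_chordal_bipartite_graph_axioms_def chordal_bipartite_graph_def by blast
    then interpret numbered_chordal_bipartite_graph G A B "card (pverts G)" "matrix_of_graph G" .
    let ?n = "card (pverts G)" and ?M = "matrix_of_graph G" and ?N = num_solutions
    have "fst ((enum_step ^^ k) (enum_step ([], ?M, []))) \<noteq> []" if "k < ?N" for k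
      using that by (simp add: enum_steps)
    moreover have "fst ((enum_step ^^ ?N) (enum_step ([], ?M, []))) = []"
      by (simp add: enum_steps)
    moreover have "sz ((enum_step ^^ k) (enum_step ([], ?M, []))) \<le> Q (sz ?M + k)" if "k \<le> ?N" for k
      unfolding Q_def using sz_enum_steps[OF that] .
    ultimately obtain t out s' where run: "exec c (initial_state (encode ?M)) t out s'"
      and out: "map snd out = map (\<lambda>k. encode (hd (fst ((enum_step ^^ k) (enum_step ([], ?M, [])))))) [0..<?N]"
      and time: "\<forall>i<?N. fst (out ! i) \<le> p (sz ?M + Suc i)" "t \<le> p (sz ?M + ?N)"
      using c[of ?N ?M] by blast
    have "map snd out = map (\<lambda>k. tree_of_set ?n (set (find_new ?M (found k)))) [0..<?N]"
      unfolding out by (intro map_cong) (auto simp: enum_steps tree_of_set_eq_encode)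
    also have "\<dots> = rev (map (\<lambda>g. tree_of_set ?n (set g)) (found ?N))" by (rule map_found)
    finally have outputs: "map snd out = rev (map (tree_of_set ?n) (map set (found ?N)))"
      by (simp add: comp_def)
    have "distinct (map set (found ?N))" using found_props by simp
    \<comment> \<open>Distinct solutions must also have distinct encodings for the outputs to be
      distinct.\<close>
    moreover have "inj_on (tree_of_set ?n) (set (map set (found ?N)))"
      by (rule inj_on_subset[OF inj_on_tree_of_set])
         (use set_found minimal_cds_subset_V numbered in auto)
    ultimately have dist: "distinct (map snd out)" 
      unfolding outputs distinct_rev by (subst distinct_map) (rule conjI)
    have set: "set (map snd out) = tree_of_set ?n ` {D. minimal_cds D}"
      by (simp only: outputs set_rev set_map set_found)
    have len: "length out = ?N" using arg_cong[OF out, of length] by simp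
    show "\<exists>t out s'. exec c (initial_state (tree_of_graph G)) t out s' \<and> distinct (map snd out) \<and>
        set (map snd out) = tree_of_set ?n ` {D. minimal_cds D} \<and>
        (\<forall>i\<in>{1..length out}. fst (out ! (i - 1)) \<le> poly P (size (tree_of_graph G) + i)) \<and>
        t \<le> poly P (size (tree_of_graph G) + length out)"
      unfolding tree_of_graph_eq_encode
    proof (intro exI conjI ballI)
      fix i assume "i \<in> {1..length out}"
      then show "fst (out ! (i - 1)) \<le> poly P (sz ?M + i)"
        using time(1)[rule_format, of "i - 1"] len P by auto
    qed (use run dist set time(2) len P in auto)
  qed
qed

end
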